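(* Let $q>2$ be a prime power. If $\mathcal{U}$ is a non-classical Buekenhout unital of $\mathrm{PG}(2,q^2)$, then the graph $\Gamma_{\mathcal{U}}$ is not isomorphic to $\mathrm{NU}(3,q^2)$.
   Context: A unital of $\mathrm{PG}(2,q^2)$ is a set $\mathcal{U}$ of $q^3+1$ points such that every line meets $\mathcal{U}$ in either $1$ or $q+1$ points; a line meeting $\mathcal{U}$ in exactly one point is called tangent to $\mathcal{U}$. For a unital $\mathcal{U}$ of $\mathrm{PG}(2,q^2)$, $\Gamma_{\mathcal{U}}$ is the graph whose vertices are the points of $\mathrm{PG}(2,q^2)\setminus\mathcal{U}$, two distinct vertices $P_1,P_2$ being adjacent if the line $P_1P_2$ is tangent to $\mathcal{U}$. A non-degenerate Hermitian curve $\mathcal{H}(2,q^2)$ (the set of absolute points of a unitary polarity) is a unital, called the classical unital, and $\mathrm{NU}(3,q^2)=\Gamma_{\mathcal{H}(2,q^2)}$. A Buekenhout unital is either an orthogonal Buekenhout-Metz unital or a Buekenhout-Tits unital. For $q>2$, an orthogonal Buekenhout-Metz unital is one projectively equivalent to $$\mathcal{U}_{\alpha,\beta}=\{(x,\alpha x^2+\beta x^{q+1}+z,1) : z\in \mathrm{GF}(q),\ x\in \mathrm{GF}(q^2)\}\cup\{(0,1,0)\},$$ where $\alpha,\beta\in \mathrm{GF}(q^2)$ are such that $(\beta-\beta^q)^2+4\alpha^{q+1}$ is a non-square in $\mathrm{GF}(q)$ if $q$ is odd, or $\beta\notin \mathrm{GF}(q)$ and $\alpha^{q+1}/(\beta+\beta^q)^2$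 has absolute trace $0$ if $q$ is even. The unital $\mathcal{U}_{\alpha,\beta}$ is classical if and only if $\alpha=0$. For $q=2^m$, $m>1$ odd, a Buekenhout-Tits unital is one projectively equivalent to $$\mathcal{U}_T=\{(x_0+x_1\beta,(x_0^{\delta+2}+x_0x_1+x_1^{\delta})\beta+z,1) : x_0,x_1,z\in \mathrm{GF}(q)\}\cup\{(0,1,0)\},$$ where $\beta\in \mathrm{GF}(q^2)\setminus \mathrm{GF}(q)$ and $\delta=2^{(m+1)/2}$. Non-classical means not a Hermitian curve. *)

theory Defs
  imports
    "HOL-Analysis.Cartesian_Space"
    "HOL-Number_Theory.Prime_Powers"
    "Graph_Theory.Graph_Theory"
begin

text \<open>
  The plane PG(2,q^2) is modelled on the vector space \<open>'k ^ 3\<close> over a finite field \<open>'k\<close> with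
  \<open>CARD('k) = q ^ 2\<close>: points and lines are the subspaces of dimension 1 and 2, incidence is
  inclusion. The number \<open>q\<close> is passed explicitly where it matters.
\<close>

definition points :: "('k::{field,finite} ^ 3) set set" where
  "points = {P. vec.subspace P \<and> vec.dim P = 1}"

definition lines :: "('k::{field,finite} ^ 3) set set" where
  "lines = {L. vec.subspace L \<and> vec.dim L = 2}"

definition pt :: "'k::{field,finite} \<Rightarrow> 'k \<Rightarrow> 'k \<Rightarrow> ('k ^ 3) set" where
  "pt x y z = vec.span {vector [x, y, z]}"

definition line_through ::
    "('k::{field,finite} ^ 3) set \<Rightarrow> ('k ^ 3) set \<Rightarrow> ('k ^ 3) set" where
  "line_through P Q = vec.span (P \<union> Q)"

definition tangent :: "('k::{field,finite} ^ 3) set set \<Rightarrow> ('k ^ 3) set \<Rightarrow> bool" where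
  "tangent U L \<longleftrightarrow> L \<in> lines \<and> card {P \<in> U. P \<subseteq> L} = 1"

text \<open>Equivalence under the group PGL(3,q^2).\<close>

definition proj_equiv ::
    "('k::{field,finite} ^ 3) set set \<Rightarrow> ('k ^ 3) set set \<Rightarrow> bool" where
  "proj_equiv U V \<longleftrightarrow>
     (\<exists>M :: 'k ^ 3 ^ 3. invertible M \<and> V = (\<lambda>P. (\<lambda>v. M *v v) ` P) ` U)"

text \<open>
  Graphs are symmetric loop-free digraphs. The definition makes sense for every set \<open>U\<close> of
  points, so that being a unital need not be part of it.
\<close>

definition tangent_graph ::
    "('k::{field,finite} ^ 3) set set \<Rightarrow> ('k ^ 3) set pair_pre_digraph" where
  "tangent_graph U =
     \<lparr>pverts = points - U,
      parcs = {(P, Q). P \<in> points - U \<and> Q \<in> points - U \<and> P \<noteq> Q \<and> tangent U (line_through P Q)}\<rparr>"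

lemma pair_graph_tangent_graph: "pair_graph (tangent_graph U)"
  by unfold_locales
    (auto simp: tangent_graph_def line_through_def symmetric_def sym_def Un_commute)

lemma digraph_iso_tangent_graph_iff:
  fixes U V :: "('k::{field,finite} ^ 3) set set"
  shows "digraph_iso (with_proj (tangent_graph U)) (with_proj (tangent_graph V)) \<longleftrightarrow>
     (\<exists>f. bij_betw f (points - U) (points - V) \<and>
       (\<forall>P \<in> points - U. \<forall>Q \<in> points - U.
          (P, Q) \<in> parcs (tangent_graph U) \<longleftrightarrow> (f P, f Q) \<in> parcs (tangent_graph V)))"
proof
  let ?G = "with_proj (tangent_graph U)" and ?H = "with_proj (tangent_graph V)"
  assume "digraph_iso ?G ?H"
  then obtain h where iso: "pre_digraph.digraph_isomorphism ?G h" and H: "?H = app_iso h ?G"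
    unfolding digraph_iso_def by blast
  let ?f = "iso_verts h"
  have verts: "?f ` (points - U) = points - V"
    using arg_cong[OF H, of verts] by (simp add: tangent_graph_def)
  have arcs: "parcs (tangent_graph V) = iso_arcs h ` parcs (tangent_graph U)"
    using arg_cong[OF H, of arcs] by simp
  have tl: "iso_tail h = fst" and hd: "iso_head h = snd"
    using arg_cong[OF H, of tail] arg_cong[OF H, of head] by simp_all
  have inj: "inj_on ?f (points - U)"
    using iso by (simp add: pre_digraph.digraph_isomorphism_def tangent_graph_def)
  have arc: "iso_arcs h a = (?f (fst a), ?f (snd a))" if "a \<in> parcs (tangent_graph U)" for a
    using iso that by (simp add: pre_digraph.digraph_isomorphism_def tl hd prod_eq_iff)
  have sub: "parcs (tangent_graph U) \<subseteq> (points - U) \<times> (points - U)"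
    by (auto simp: tangent_graph_def)
  have "(P, Q) \<in> parcs (tangent_graph U) \<longleftrightarrow> (?f P, ?f Q) \<in> parcs (tangent_graph V)"
    if "P \<in> points - U" "Q \<in> points - U" for P Q
  proof
    assume "(P, Q) \<in> parcs (tangent_graph U)"
    then show "(?f P, ?f Q) \<in> parcs (tangent_graph V)"
      unfolding arcs using arc by force
  next
    assume "(?f P, ?f Q) \<in> parcs (tangent_graph V)"
    then obtain P' Q' where a: "(P', Q') \<in> parcs (tangent_graph U)"
      and e: "(?f P, ?f Q) = iso_arcs h (P', Q')"
      unfolding arcs by auto
    have "P' \<in> points - U" "Q' \<in> points - U" "?f P = ?f P'" "?f Q = ?f Q'"
      using a e sub arc[OF a] by auto
    then have "P = P'" "Q = Q'" using inj that by (auto dest: inj_onD)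
    then show "(P, Q) \<in> parcs (tangent_graph U)" using a by simp
  qed
  then show "\<exists>f. bij_betw f (points - U) (points - V) \<and>
       (\<forall>P \<in> points - U. \<forall>Q \<in> points - U.
          (P, Q) \<in> parcs (tangent_graph U) \<longleftrightarrow> (f P, f Q) \<in> parcs (tangent_graph V))"
    using inj verts unfolding bij_betw_def by blast
next
  let ?G = "with_proj (tangent_graph U)" and ?H = "with_proj (tangent_graph V)"
  assume "\<exists>f. bij_betw f (points - U) (points - V) \<and>
       (\<forall>P \<in> points - U. \<forall>Q \<in> points - U.
          (P, Q) \<in> parcs (tangent_graph U) \<longleftrightarrow> (f P, f Q) \<in> parcs (tangent_graph V))"
  then obtain f where inj: "inj_on f (points - U)" and im: "f ` (points - U) = points - V"
    and adj: "\<And>P Q. P \<in> points - U \<Longrightarrow> Q \<in> points - U \<Longrightarrow>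
       (P, Q) \<in> parcs (tangent_graph U) \<longleftrightarrow> (f P, f Q) \<in> parcs (tangent_graph V)"
    unfolding bij_betw_def by (elim exE conjE) (metis)
  define h where "h = \<lparr>iso_verts = f, iso_arcs = map_prod f f, iso_head = snd, iso_tail = fst\<rparr>"
  have sub: "parcs (tangent_graph W) \<subseteq> (points - W) \<times> (points - W)" for W :: "('k ^ 3) set set"
    by (auto simp: tangent_graph_def)
  interpret pair_graph "tangent_graph U" by (rule pair_graph_tangent_graph)
  have arcs: "parcs (tangent_graph V) = map_prod f f ` parcs (tangent_graph U)"
  proof
    show "map_prod f f ` parcs (tangent_graph U) \<subseteq> parcs (tangent_graph V)"
      using sub[of U] adj by auto
    show "parcs (tangent_graph V) \<subseteq> map_prod f f ` parcs (tangent_graph U)"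
    proof
      fix a assume a: "a \<in> parcs (tangent_graph V)"
      then have "fst a \<in> f ` (points - U)" "snd a \<in> f ` (points - U)"
        unfolding im using sub[of V] by auto
      then obtain P Q where PQ: "P \<in> points - U" "Q \<in> points - U" "a = (f P, f Q)"
        by (metis imageE prod.collapse)
      then have "(P, Q) \<in> parcs (tangent_graph U)" using a adj by simp
      then show "a \<in> map_prod f f ` parcs (tangent_graph U)" using PQ(3) by force
    qed
  qed
  have verts: "pverts (tangent_graph W) = points - W" for W :: "('k ^ 3) set set"
    by (simp add: tangent_graph_def)
  have "inj_on (map_prod f f) (parcs (tangent_graph U))"
    using inj_on_subset[OF map_prod_inj_on[OF inj inj] sub] .
  then have "pre_digraph.digraph_isomorphism ?G h"
    unfolding pre_digraph.digraph_isomorphism_def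
    using inj wf_digraph by (simp add: h_def verts)
  moreover have "?H = app_iso h ?G"
    by (simp add: app_iso_def h_def with_proj_def verts arcs im)
  ultimately show "digraph_iso ?G ?H" unfolding digraph_iso_def by blast
qed

text \<open>
  A unitary polarity maps each subspace to its orthogonal complement with respect to a
  non-degenerate Hermitian form; the involution of GF(q^2) is \<open>x \<mapsto> x ^ q\<close>.
\<close>

definition hermitian_form ::
    "nat \<Rightarrow> 'k::{field,finite} ^ 3 ^ 3 \<Rightarrow> 'k ^ 3 \<Rightarrow> 'k ^ 3 \<Rightarrow> 'k" where
  "hermitian_form q A v w = (\<Sum>i\<in>UNIV. \<Sum>j\<in>UNIV. v $ i * A $ i $ j * (w $ j) ^ q)"

definition unitary_polarity ::
    "nat \<Rightarrow> (('k::{field,finite} ^ 3) set \<Rightarrow> ('k ^ 3) set) \<Rightarrow> bool" where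
  "unitary_polarity q \<rho> \<longleftrightarrow>
     (\<exists>A. invertible A \<and> (\<forall>i j. A $ j $ i = (A $ i $ j) ^ q) \<and>
        (\<forall>S. vec.subspace S \<longrightarrow> \<rho> S = {v. \<forall>w\<in>S. hermitian_form q A v w = 0}))"

text \<open>A point is absolute if it is incident with its image under the polarity.\<close>

definition hermitian_curve :: "nat \<Rightarrow> ('k::{field,finite} ^ 3) set set \<Rightarrow> bool" where
  "hermitian_curve q H \<longleftrightarrow> (\<exists>\<rho>. unitary_polarity q \<rho> \<and> H = {P \<in> points. P \<subseteq> \<rho> P})"

text \<open>The subfield GF(q) of GF(q^2).\<close>

definition GFq :: "nat \<Rightarrow> 'k::{field,finite} set" where
  "GFq q = {x. x ^ q = x}"

text \<open>The absolute trace from GF(2^m) to GF(2).\<close>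

definition abs_trace :: "nat \<Rightarrow> 'k::{field,finite} \<Rightarrow> 'k" where
  "abs_trace m x = (\<Sum>i<m. x ^ (2 ^ i))"

definition BM_set :: "nat \<Rightarrow> 'k::{field,finite} \<Rightarrow> 'k \<Rightarrow> ('k ^ 3) set set" where
  "BM_set q \<alpha> \<beta> =
     {pt x (\<alpha> * x ^ 2 + \<beta> * x ^ (q + 1) + z) 1 | x z. z \<in> GFq q} \<union> {pt 0 1 0}"

definition BM_params :: "nat \<Rightarrow> 'k::{field,finite} \<Rightarrow> 'k \<Rightarrow> bool" where
  "BM_params q \<alpha> \<beta> \<longleftrightarrow>
     (odd q \<and> \<not> (\<exists>t\<in>GFq q. (\<beta> - \<beta> ^ q) ^ 2 + 4 * \<alpha> ^ (q + 1) = t ^ 2)) \<or>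
     (\<exists>m. q = 2 ^ m \<and> even q \<and> \<beta> \<notin> GFq q \<and> abs_trace m (\<alpha> ^ (q + 1) / (\<beta> + \<beta> ^ q) ^ 2) = 0)"

definition orthogonal_Buekenhout_Metz_unital ::
    "nat \<Rightarrow> ('k::{field,finite} ^ 3) set set \<Rightarrow> bool" where
  "orthogonal_Buekenhout_Metz_unital q U \<longleftrightarrow>
     (\<exists>\<alpha> \<beta>. BM_params q \<alpha> \<beta> \<and> proj_equiv (BM_set q \<alpha> \<beta>) U)"

definition BT_set :: "nat \<Rightarrow> nat \<Rightarrow> 'k::{field,finite} \<Rightarrow> ('k ^ 3) set set" where
  "BT_set q \<delta> \<beta> =
     {pt (x0 + x1 * \<beta>) ((x0 ^ (\<delta> + 2) + x0 * x1 + x1 ^ \<delta>) * \<beta> + z) 1 | x0 x1 z.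
        x0 \<in> GFq q \<and> x1 \<in> GFq q \<and> z \<in> GFq q} \<union> {pt 0 1 0}"

definition Buekenhout_Tits_unital :: "nat \<Rightarrow> ('k::{field,finite} ^ 3) set set \<Rightarrow> bool" where
  "Buekenhout_Tits_unital q U \<longleftrightarrow>
     (\<exists>m \<beta>. q = 2 ^ m \<and> m > 1 \<and> odd m \<and> \<beta> \<notin> GFq q \<and>
        proj_equiv (BT_set q (2 ^ ((m + 1) div 2)) \<beta>) U)"

definition Buekenhout_unital :: "nat \<Rightarrow> ('k::{field,finite} ^ 3) set set \<Rightarrow> bool" where
  "Buekenhout_unital q U \<longleftrightarrow>
     orthogonal_Buekenhout_Metz_unital q U \<or> Buekenhout_Tits_unital q U"

end

theory Submission
  imports Defs "HOL-Computational_Algebra.Polynomial"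
begin

text \<open>
  Fix a unital \<open>U\<close>. A tangent line contributes a clique to its graph, and the points off \<open>U\<close> are the
  blocks of a design on these cliques, so the graph remembers the unital of tangent lines in
  the dual plane. The proof finds a property of that unital, visible in the graph, that holds for
  Hermitian curves and fails for non-classical Buekenhout unitals.

  In the Hermitian case each point \<open>p\<close> of the curve is the centre of elations preserving the curve,
  with axis the tangent line at \<open>p\<close>. An elation moves a point \<open>P\<close> off the axis to a point \<open>P'\<close> that is
  not adjacent to \<open>P\<close> but has the same neighbours on the axis. To state this as a property of the
  bare graph one has to recognise the axis: cliques with at least \<open>q + 3\<close> points lie on tangent
  lines, because four pairwise adjacent points contain three collinear ones
  (\<open>four_clique_collinear\<close>). The resulting property is \<open>elation_property\<close>. It holds for
  the Hermitian curve (\<open>elation_property_curve\<close>) and is invariant under graph isomorphism.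

  A Buekenhout unital is, up to equivalence, \<open>y - cj y = \<Phi> x\<close> together with one point at infinity,
  and the line \<open>y = m x + k\<close> is tangent if and only if \<open>k - cj k = \<Psi> m\<close> for a function \<open>\<Psi>\<close> of the same
  kind as \<open>\<Phi>\<close>. Taking the tangent \<open>y = 0\<close> as clique and a point at infinity as \<open>P\<close>, the elation
  property turns into one functional equation for \<open>\<Psi>\<close>, valid on a coset of \<open>GF(q)\<close>
  (\<open>elation_property_affine_curve\<close>). Geometrically: \<open>\<Psi>\<close> agrees with a linear function on a circle
  through the origin.

  For Buekenhout-Metz unitals \<open>\<Psi>\<close> is a quadratic form, and two conics with that many common points
  coincide, so \<open>\<Psi>\<close> is a multiple of the norm and the unital is classical
  (\<open>quad_elation_equation\<close>); for \<open>q = 3\<close> four common points are not enough, but there the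
  condition on the parameters forces \<open>\<beta>\<close> to be in \<open>GF(q)\<close>, which settles the case. For Buekenhout-Tits unitals the circle has a rational parametrisation
  whose substitution yields an identity between polynomials of degree less than \<open>q\<close> (for \<open>q = 8\<close> after reduction) that cannot hold
  (\<open>tits_polynomial_identity\<close>). So no graph of a non-classical Buekenhout unital has
  the elation property.
\<close>

section \<open>The field with \<open>q\<^sup>2\<close> elements\<close>

locale quadratic_field =
  fixes q :: nat and field_type :: "'k::{field,finite} itself"
  assumes primepow_q: "primepow q" and q_gt_2: "q > 2" and card_k: "CARD('k) = q ^ 2"
begin

text \<open>
  The conjugation \<open>x \<mapsto> x ^ q\<close> has a name of its own because the arguments below only use that it
  is an involutory automorphism with fixed field \<open>F\<close>; as a power it would be expanded.
\<close>

definition cj :: "'k \<Rightarrow> 'k" where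
  "cj x = x ^ q"

definition nm :: "'k \<Rightarrow> 'k" where
  "nm x = x * cj x"

abbreviation F :: "'k set" where
  "F \<equiv> {x. cj x = x}"

lemma card_k_zero: "(of_nat CARD('k) :: 'k) = 0"
proof -
  have "(\<Sum>x\<in>(UNIV::'k set). x) = (\<Sum>x\<in>UNIV. x + 1)"
    by (rule sum.reindex_bij_witness[of _ "\<lambda>x. x + 1" "\<lambda>x. x - 1"]) auto
  then show ?thesis by (simp add: sum.distrib)
qed

lemma prime_char: "prime CHAR('k)"
  by (intro prime_CHAR_semidom finite_imp_CHAR_pos) auto

lemma q_char_power: "\<exists>n. q = CHAR('k) ^ n"
proof -
  obtain p n where pn: "prime p" "q = p ^ n"
    using primepow_q unfolding primepow_def by auto
  have "CHAR('k) dvd q ^ 2"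
    using card_k_zero by (simp add: card_k of_nat_eq_0_iff_char_dvd del: of_nat_power)
  then have "CHAR('k) dvd p"
    using prime_char pn by (auto dest: prime_dvd_power)
  then have "CHAR('k) = p"
    using prime_char pn(1) by (simp add: primes_dvd_imp_eq)
  then show ?thesis using pn by auto
qed

lemma cj_add [simp]: "cj (x + y) = cj x + cj y"
  unfolding cj_def using freshmans_dream'[OF prime_char] q_char_power by blast

lemma cj_0 [simp]: "cj 0 = 0" and cj_1 [simp]: "cj 1 = 1"
  using q_gt_2 by (simp_all add: cj_def)

lemma cj_mult [simp]: "cj (x * y) = cj x * cj y"
  and cj_power [simp]: "cj (x ^ n) = cj x ^ n"
  and cj_divide [simp]: "cj (x / y) = cj x / cj y"
  by (simp_all add: cj_def power_mult_distrib power_divide flip: power_mult)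
     (simp_all add: mult.commute)

lemma cj_minus [simp]: "cj (- x) = - cj x"
  using cj_add[of x "- x"] by (simp add: eq_neg_iff_add_eq_0 add.commute)

lemma cj_diff [simp]: "cj (x - y) = cj x - cj y"
  using cj_add[of x "- y"] by simp

lemma cj_of_nat [simp]: "cj (of_nat n) = of_nat n"
  by (induction n) auto

lemma cj_numeral [simp]: "cj (numeral n) = numeral n"
  using cj_of_nat[of "numeral n"] by simp

lemma cj_eq_0_iff [simp]: "cj x = 0 \<longleftrightarrow> x = 0"
  using q_gt_2 by (simp add: cj_def)

lemma nm_eq_0_iff: "nm x = 0 \<longleftrightarrow> x = 0"
  by (simp add: nm_def)

lemma cj_sum [simp]: "cj (sum f A) = (\<Sum>a\<in>A. cj (f a))"
  by (induction A rule: infinite_finite_induct) auto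

lemma power_card_k: "x ^ CARD('k) = (x :: 'k)"
proof (cases "x = 0")
  case False
  have "x * (\<Prod>y\<in>UNIV-{0}. x * y) = x * x ^ (CARD('k) - 1) * \<Prod>(UNIV-{0})"
    by (simp add: prod.distrib mult_ac)
  also have "x * x ^ (CARD('k) - 1) = x ^ Suc (CARD('k) - 1)"
    by (subst power_Suc) auto
  also have "Suc (CARD('k) - 1) = CARD('k)"
    using finite_UNIV_card_ge_0[where ?'a = 'k, OF finite] by linarith
  also have "(\<Prod>y\<in>UNIV-{0}. x * y) = (\<Prod>y\<in>UNIV-{0}. y)"
    by (rule prod.reindex_bij_witness[of _ "\<lambda>y. y / x" "\<lambda>y. x * y"]) (use False in auto)
  finally show ?thesis by simp
qed (use finite_UNIV_card_ge_0[where ?'a = 'k] in auto)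

lemma cj_cj [simp]: "cj (cj x) = x"
  using power_card_k[of x] by (simp add: cj_def card_k power2_eq_square flip: power_mult)

lemma card_roots_le:
  fixes p :: "'k poly"
  assumes "\<And>x. x \<in> A \<Longrightarrow> poly p x = 0" "degree p < card A"
  shows "p = 0"
proof (rule ccontr)
  assume "p \<noteq> 0"
  have "card A \<le> card {x. poly p x = 0}"
    by (rule card_mono) (use assms in auto)
  with card_poly_roots_bound[OF \<open>p \<noteq> 0\<close>] assms(2) show False by simp
qed

lemma card_linear_cj_le:
  assumes "b \<noteq> 0"
  shows "card {x. a * cj x + b * x = 0} \<le> q"
proof -
  let ?p = "monom a q + monom b 1"
  have "coeff ?p 1 = b" using q_gt_2 by simp
  then have "?p \<noteq> 0" using assms by (metis coeff_0)
  then have "card {x. poly ?p x = 0} \<le> degree ?p" by (rule card_poly_roots_bound)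
  also have "degree ?p \<le> q"
    using q_gt_2 by (intro degree_add_le order.trans[OF degree_monom_le]) auto
  finally show ?thesis by (simp add: poly_monom cj_def)
qed

lemma card_norm_fiber_le: "card {x. nm x = a} \<le> q + 1"
proof -
  let ?p = "monom 1 (q + 1) - [:a:]"
  have deg: "degree ?p \<le> q + 1"
    by (intro degree_diff_le order.trans[OF degree_monom_le]) auto
  have "coeff ?p (q + 1) = 1" by (simp add: coeff_pCons)
  then have "?p \<noteq> 0" by (metis coeff_0 zero_neq_one)
  from card_poly_roots_bound[OF this] deg
  show ?thesis by (simp add: poly_monom cj_def nm_def)
qed

lemma card_fiber_eq_card_F:
  assumes "y - cj y = a"
  shows "card {x. x - cj x = a} = card F"
proof (rule sym, rule bij_betw_same_card[of "\<lambda>x. x + y"])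
  have "cj (x - y) = x - y" if "x - cj x = a" for x
  proof -
    have "(x - y) - cj (x - y) = (x - cj x) - (y - cj y)" by simp
    then show ?thesis using that assms by simp
  qed
  then show "bij_betw (\<lambda>x. x + y) F {x. x - cj x = a}"
    by (intro bij_betw_byWitness[where f' = "\<lambda>x. x - y"]) (use assms in auto)
qed

text \<open>
  The additive map \<open>x \<mapsto> x - cj x\<close> has kernel \<open>F\<close> and image inside the zeros of \<open>x + cj x\<close>. Both
  have at most \<open>q\<close> elements and the domain has \<open>q\<^sup>2\<close>, so neither bound has any slack.
\<close>

lemma
  shows card_F: "card F = q"
    and trace_zero_eq_image: "cj a = - a \<Longrightarrow> \<exists>x. x - cj x = a"
proof -
  let ?T = "{a. cj a + a = 0}"
  let ?I = "range (\<lambda>x. x - cj x)"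
  have F_le: "card F \<le> q"
    using card_linear_cj_le[of "-1" 1] by (simp add: eq_neg_iff_add_eq_0 algebra_simps)
  have T_le: "card ?T \<le> q" using card_linear_cj_le[of 1 1] by simp
  have IT: "?I \<subseteq> ?T" by auto
  have "CARD('k) = card (\<Union>a\<in>?I. {x. x - cj x = a})" by (rule arg_cong[of _ _ card]) auto
  also have "\<dots> = (\<Sum>a\<in>?I. card {x. x - cj x = a})"
    by (rule card_UN_disjoint) auto
  also have "\<dots> = (\<Sum>a\<in>?I. card F)"
    by (intro sum.cong refl) (auto intro: card_fiber_eq_card_F)
  also have "\<dots> = card ?I * card F" by simp
  finally have eq: "q * q = card ?I * card F" by (simp add: card_k power2_eq_square)
  have I_le: "card ?I \<le> card ?T" using IT by (intro card_mono) auto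
  have "q * q \<le> q * card F" unfolding eq using I_le T_le by (intro mult_right_mono) auto
  then have F_q: "card F = q" using F_le q_gt_2 by auto
  then have "card ?I = q" using eq q_gt_2 by simp
  then have "?I = ?T" using IT T_le by (intro card_seteq) auto
  show "card F = q" by (rule F_q)
  assume "cj a = - a"
  then have "a \<in> ?T" by simp
  with \<open>?I = ?T\<close> have "a \<in> ?I" by metis
  then show "\<exists>x. x - cj x = a" by blast
qed

lemma card_fiber:
  assumes "cj a = - a"
  shows "card {x. x - cj x = a} = q"
  using trace_zero_eq_image[OF assms] card_fiber_eq_card_F card_F by metis

lemma not_in_F: "\<exists>w. cj w \<noteq> w"
proof (rule ccontr)
  assume "\<not> ?thesis"
  then have "F = UNIV" by auto
  then have "q = CARD('k)" using card_F by metis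
  then show False using q_gt_2 by (simp add: card_k power2_eq_square)
qed

lemma norm_one_witness: "\<exists>x. nm x = 1 \<and> x \<noteq> 1"
proof -
  \<comment> \<open>The elements of norm one are the quotients \<open>cj w / w\<close>.\<close>
  obtain w where w: "cj w \<noteq> w" using not_in_F by blast
  then have "w \<noteq> 0" by auto
  with w have "nm (cj w / w) = 1" "cj w / w \<noteq> 1" by (auto simp: nm_def)
  then show ?thesis by blast
qed

text \<open>
  Multiplication by elements of norm one permutes a fibre of the norm, so only the fibre over \<open>0\<close> is
  a singleton.
\<close>

lemma card_norm_fiber_eq_1: "card {z. nm z = a} = 1 \<longleftrightarrow> a = 0"
proof
  assume "a = 0"
  then have "{z. nm z = a} = {0}" by (auto simp: nm_def)
  then show "card {z. nm z = a} = 1" by simp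
next
  assume "card {z. nm z = a} = 1"
  then obtain z where z: "{z. nm z = a} = {z}" by (auto simp: card_1_singleton_iff)
  obtain x where x: "nm x = 1" "x \<noteq> 1" using norm_one_witness by blast
  have za: "nm z = a" using z by auto
  then have "nm (z * x) = a"
    using x(1) by (simp add: nm_def) (metis (no_types, lifting) mult.assoc mult.left_commute mult.right_neutral)
  then have "z * x \<in> {z. nm z = a}" by simp
  then have "z * x = z" unfolding z by simp
  then have "z = 0" using x(2) by simp
  then show "a = 0" using za by (simp add: nm_def)
qed

end

section \<open>Points, lines and tangency in the projective plane\<close>

lemma in_span_singleton: "w \<in> vec.span {v} \<longleftrightarrow> (\<exists>a. w = a *s v)"
  for v w :: "'k::{field,finite} ^ 3"
  by (auto simp: vec.span_singleton)

lemma mem_span_singleton_self: "v \<in> vec.span {v}"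
  for v :: "'k::{field,finite} ^ 3"
  by (simp add: vec.span_base)

lemma in_span_pair: "w \<in> vec.span {u, v} \<longleftrightarrow> (\<exists>a b. w = a *s u + b *s v)"
  for u v w :: "'k::{field,finite} ^ 3"
  unfolding vec.span_breakdown_eq[of w u] in_span_singleton by (simp add: diff_eq_eq add.commute)

lemma point_span: "v \<noteq> 0 \<Longrightarrow> vec.span {v} \<in> points"
  for v :: "'k::{field,finite} ^ 3"
  by (simp add: points_def)

lemma pointE:
  assumes "P \<in> points"
  obtains v where "v \<noteq> 0" "P = vec.span {v}"
proof -
  from assms have P: "vec.subspace P" "vec.dim P = 1" by (auto simp: points_def)
  have "\<not> P \<subseteq> {0}" using P(2) by (simp flip: vec.dim_eq_0)
  then obtain v where v: "v \<in> P" "v \<noteq> 0" by blast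
  have "vec.span {v} = P"
    by (rule vec.subspace_dim_equal)
      (use P v in \<open>auto intro: vec.span_minimal[THEN subsetD]\<close>)
  with v that show thesis by blast
qed

lemma span_eq_span_iff:
  fixes u v :: "'k::{field,finite} ^ 3"
  assumes "u \<noteq> 0" "v \<noteq> 0"
  shows "vec.span {u} = vec.span {v} \<longleftrightarrow> (\<exists>c. u = c *s v)"
proof
  assume "vec.span {u} = vec.span {v}"
  then have "u \<in> vec.span {v}" by (metis insertI1 vec.span_base)
  then show "\<exists>c. u = c *s v" by (simp add: in_span_singleton)
next
  assume "\<exists>c. u = c *s v"
  then have "vec.span {u} \<subseteq> vec.span {v}"
    by (intro vec.span_minimal) (auto simp: in_span_singleton)
  then show "vec.span {u} = vec.span {v}"
    by (intro vec.subspace_dim_equal) (use assms in auto)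
qed

lemma line_through_span: "line_through (vec.span {u}) (vec.span {v}) = vec.span {u, v}"
proof -
  have "vec.span {u} \<subseteq> vec.span {u, v}" "vec.span {v} \<subseteq> vec.span {u, v}"
    by (intro vec.span_mono; blast)+
  moreover have "u \<in> vec.span {u}" "v \<in> vec.span {v}" by (simp_all add: vec.span_base)
  then have "{u, v} \<subseteq> vec.span (vec.span {u} \<union> vec.span {v})"
    using vec.span_superset[of "vec.span {u} \<union> vec.span {v}"] by blast
  ultimately show ?thesis by (simp add: line_through_def vec.span_eq)
qed

lemma dim_span_pair:
  fixes u v :: "'k::{field,finite} ^ 3"
  assumes "u \<noteq> 0" "v \<noteq> 0" "vec.span {u} \<noteq> vec.span {v}"
  shows "vec.dim (vec.span {u, v}) = 2"
proof -
  have "u \<notin> vec.span {v}" using assms by (simp add: span_eq_span_iff in_span_singleton)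
  then show ?thesis using assms by (simp add: vec.dim_insert)
qed

lemma line_through_in_lines:
  "P \<in> points \<Longrightarrow> Q \<in> points \<Longrightarrow> P \<noteq> Q \<Longrightarrow> line_through P Q \<in> lines"
  unfolding lines_def by (elim pointE) (use dim_span_pair in \<open>auto simp only: line_through_span mem_Collect_eq vec.subspace_span\<close>)

text \<open>
  Lines are mostly given by equations. A proper subspace has dimension at most 2, so no dimension
  has to be computed to recognise it as the line through two of its points.
\<close>

lemma line_through_eq_proper_subspace:
  assumes "P \<in> points" "Q \<in> points" "P \<noteq> Q" "P \<subseteq> S" "Q \<subseteq> S" "vec.subspace S" "S \<noteq> UNIV"
  shows "line_through P Q = S"
proof (rule vec.subspace_dim_equal)
  show "vec.subspace (line_through P Q)" by (simp add: line_through_def)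
  show "line_through P Q \<subseteq> S"
    unfolding line_through_def using assms by (intro vec.span_minimal) auto
  have "vec.dim (line_through P Q) = 2"
    using line_through_in_lines[OF assms(1-3)] by (simp add: lines_def)
  moreover have "vec.dim S \<noteq> 3"
  proof
    assume "vec.dim S = 3"
    then have "vec.span S = UNIV"
      using vec.dim_eq_full[of S] by (simp add: card_cart_basis vec.dimension_def)
    moreover have "vec.span S = S" using assms(6) by (rule vec.span_eq_iff[THEN iffD2])
    ultimately show False using assms(7) by metis
  qed
  moreover have "vec.dim S \<le> 3"
    using vec.dim_subset_UNIV[of S] by (simp add: card_cart_basis vec.dimension_def)
  ultimately show "vec.dim (line_through P Q) \<ge> vec.dim S" by simp
qed (use assms in auto)

lemma line_through_eqI:
  assumes "P \<in> points" "Q \<in> points" "P \<noteq> Q" "P \<subseteq> L" "Q \<subseteq> L" "L \<in> lines"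
  shows "line_through P Q = L"
proof (rule line_through_eq_proper_subspace)
  show "L \<noteq> UNIV"
    using assms(6) by (auto simp: lines_def vec.dim_UNIV card_cart_basis)
qed (use assms in \<open>auto simp: lines_def\<close>)

lemma subset_line_through: "P \<subseteq> line_through P Q" "Q \<subseteq> line_through P Q"
  unfolding line_through_def using vec.span_superset by blast+

definition adj :: "('k::{field,finite} ^ 3) set set \<Rightarrow> ('k ^ 3) set \<Rightarrow> ('k ^ 3) set \<Rightarrow> bool" where
  "adj U P Q \<longleftrightarrow> P \<noteq> Q \<and> tangent U (line_through P Q)"

text \<open>
  The trace that elations leave in the graph: an elation whose axis contains the clique \<open>S\<close>
  moves \<open>P\<close> without changing which members of \<open>S\<close> are adjacent to it.
\<close>

definition elation_property :: "nat \<Rightarrow> 'v set \<Rightarrow> ('v \<Rightarrow> 'v \<Rightarrow> bool) \<Rightarrow> bool" where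
  "elation_property n V A \<longleftrightarrow>
     (\<forall>S P. S \<subseteq> V \<and> n \<le> card S \<and> (\<forall>Q\<in>S. \<forall>R\<in>S. Q \<noteq> R \<longrightarrow> A Q R) \<and>
        P \<in> V - S \<and> (\<exists>R\<in>S. \<not> A P R) \<longrightarrow>
        (\<exists>P'\<in>V - S. P' \<noteq> P \<and> \<not> A P P' \<and> (\<forall>R\<in>S. A P R \<longrightarrow> A P' R)))"

text \<open>
  The property speaks of vertices and adjacency only. It can therefore be pulled back along graph
  isomorphisms, and it separates two graphs as soon as one of them has it and the other does not.
\<close>

lemma elation_property_iso:
  assumes f: "bij_betw f V W" and A: "\<And>P Q. P \<in> V \<Longrightarrow> Q \<in> V \<Longrightarrow> A P Q \<longleftrightarrow> B (f P) (f Q)"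
    and W: "elation_property n W B"
  shows "elation_property n V A"
  unfolding elation_property_def
proof (intro allI impI, elim conjE bexE)
  fix S P R
  assume S: "S \<subseteq> V" "n \<le> card S" "\<forall>Q\<in>S. \<forall>R\<in>S. Q \<noteq> R \<longrightarrow> A Q R"
    and P: "P \<in> V - S" and R: "R \<in> S" "\<not> A P R"
  have inj: "inj_on f V" and im: "f ` V = W" using f by (auto simp: bij_betw_def)
  have "card (f ` S) = card S" using inj S(1) by (metis card_image inj_on_subset)
  moreover have "f P \<in> W - f ` S" using P S(1) inj im by (auto dest: inj_onD)
  moreover have "\<forall>Q\<in>f ` S. \<forall>R\<in>f ` S. Q \<noteq> R \<longrightarrow> B Q R"
  proof (intro ballI impI)
    fix Q' R' assume "Q' \<in> f ` S" "R' \<in> f ` S" "Q' \<noteq> R'"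
    then obtain Q R where "Q \<in> S" "R \<in> S" "Q' = f Q" "R' = f R" "Q \<noteq> R" by blast
    then show "B Q' R'" using S(1,3) A[of Q R] by blast
  qed
  moreover have "f ` S \<subseteq> W" using S im by auto
  moreover have "\<exists>R\<in>f ` S. \<not> B (f P) R" using R A P S by blast
  ultimately have "\<exists>Q'\<in>W - f ` S. Q' \<noteq> f P \<and> \<not> B (f P) Q' \<and> (\<forall>R\<in>f ` S. B (f P) R \<longrightarrow> B Q' R)"
    by (intro W[unfolded elation_property_def, rule_format] conjI) (simp_all add: S(2))
  then obtain Q' where Q': "Q' \<in> W - f ` S" "Q' \<noteq> f P" "\<not> B (f P) Q'"
      "\<forall>R\<in>f ` S. B (f P) R \<longrightarrow> B Q' R"
    by blast
  then obtain P' where P': "P' \<in> V" "Q' = f P'" using im by blast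
  show "\<exists>P'\<in>V - S. P' \<noteq> P \<and> \<not> A P P' \<and> (\<forall>R\<in>S. A P R \<longrightarrow> A P' R)"
  proof (intro bexI[of _ P'] conjI ballI impI)
    show "P' \<noteq> P" "P' \<in> V - S" using Q' P' by auto
    show "\<not> A P P'" using Q'(3) P' P A[of P P'] by simp
    fix R assume "R \<in> S" "A P R"
    then show "A P' R" using Q'(4) P' P S(1) A[of P R] A[of P' R] by blast
  qed
qed

lemma elation_property_digraph_iso:
  fixes U V :: "('k::{field,finite} ^ 3) set set"
  assumes "digraph_iso (with_proj (tangent_graph U)) (with_proj (tangent_graph V))"
    and "elation_property n (points - V) (adj V)"
  shows "elation_property n (points - U) (adj U)"
proof -
  have parcs: "(P, Q) \<in> parcs (tangent_graph W) \<longleftrightarrow> adj W P Q"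
    if "P \<in> points - W" "Q \<in> points - W" for P Q and W :: "('k ^ 3) set set"
    using that by (simp add: tangent_graph_def adj_def)
  obtain f where f: "bij_betw f (points - U) (points - V)"
    and A: "\<And>P Q. P \<in> points - U \<Longrightarrow> Q \<in> points - U \<Longrightarrow>
       (P, Q) \<in> parcs (tangent_graph U) \<longleftrightarrow> (f P, f Q) \<in> parcs (tangent_graph V)"
    using assms(1) unfolding digraph_iso_tangent_graph_iff by blast
  have im: "f P \<in> points - V" if "P \<in> points - U" for P
    using f that by (auto simp: bij_betw_def)
  show ?thesis
    by (rule elation_property_iso[OF f _ assms(2)]) (use A parcs im in metis)
qed

section \<open>The Hermitian curve\<close>

locale hermitian_plane = quadratic_field q field_type
  for q and field_type :: "'k::{field,finite} itself" +
  fixes h :: "'k ^ 3 \<Rightarrow> 'k ^ 3 \<Rightarrow> 'k"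
  assumes h_add [simp]: "h (u + v) w = h u w + h v w"
    and h_scale [simp]: "h (a *s u) w = a * h u w"
    and h_sym: "h w u = cj (h u w)"
    and nondegenerate: "(\<And>w. h v w = 0) \<Longrightarrow> v = 0"
begin

lemma h_add_right [simp]: "h u (v + w) = h u v + h u w"
  using h_sym[of u "v + w"] h_sym[of u v] h_sym[of u w] by simp

lemma h_scale_right [simp]: "h u (a *s w) = cj a * h u w"
  using h_sym[of u "a *s w"] h_sym[of u w] by simp

lemma cj_h [simp]: "cj (h u w) = h w u"
  by (rule h_sym[symmetric])

lemma h_0 [simp]: "h 0 w = 0"
  using h_scale[of 0 0 w] by (simp only: vector_smult_lzero mult_zero_left)

lemma h_0_right [simp]: "h w 0 = 0"
  using h_sym[of w 0] by simp

lemma h_minus [simp]: "h (- u) w = - h u w"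
  using h_add[of u "- u" w] by (simp add: eq_neg_iff_add_eq_0 add.commute del: h_add)

lemma h_diff [simp]: "h (u - v) w = h u w - h v w"
  using h_add[of u "- v" w] by (simp del: h_add)

lemma h_minus_right [simp]: "h w (- u) = - h w u"
  using h_sym[of w "- u"] by simp

lemma h_diff_right [simp]: "h w (u - v) = h w u - h w v"
  using h_sym[of w "u - v"] by simp

definition curve :: "('k ^ 3) set set" where
  "curve = {P \<in> points. \<forall>v\<in>P. \<forall>w\<in>P. h v w = 0}"

lemma span_in_curve:
  assumes "v \<noteq> 0"
  shows "vec.span {v} \<in> curve \<longleftrightarrow> h v v = 0"
proof
  assume "vec.span {v} \<in> curve"
  then show "h v v = 0" using mem_span_singleton_self[of v] unfolding curve_def by blast
qed (use assms in \<open>auto simp: curve_def point_span in_span_singleton\<close>)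

lemma off_curveE:
  assumes "P \<in> points - curve"
  obtains v where "v \<noteq> 0" "h v v \<noteq> 0" "P = vec.span {v}"
  using assms by (metis DiffE pointE span_in_curve)

lemma gram_eq_of_span_eq:
  assumes "u \<noteq> 0" "v \<noteq> 0" "vec.span {u} = vec.span {v}"
  shows "h u u * h v v = nm (h u v)"
  using assms by (auto simp: span_eq_span_iff nm_def)

text \<open>
  Completing the square turns the isotropic points of the line into a fibre of the norm, and the
  Gram determinant decides which fibre it is.
\<close>

lemma tangent_iff_gram:
  assumes u: "u \<noteq> 0" and v: "v \<noteq> 0" "h v v \<noteq> 0" and uv: "vec.span {u} \<noteq> vec.span {v}"
  shows "tangent curve (vec.span {u, v}) \<longleftrightarrow> h u u * h v v = nm (h u v)"
proof -
  define d where "d = h v v"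
  define b where "b = h u v"
  define X where "X = {x. h (u + x *s v) (u + x *s v) = 0}"
  define p where "p = (\<lambda>x. vec.span {u + x *s v})"
  have d: "d \<noteq> 0" "cj d = d" using v by (auto simp: d_def)
  have nz: "u + x *s v \<noteq> 0" for x
  proof
    assume "u + x *s v = 0"
    then have "u = (- x) *s v" by (simp add: eq_neg_iff_add_eq_0)
    then show False using u v uv span_eq_span_iff by blast
  qed
  have "inj p"
  proof (rule injI)
    fix x y assume "p x = p y"
    then obtain c where "u + x *s v = c *s (u + y *s v)"
      unfolding p_def using nz span_eq_span_iff by blast
    then have e: "(1 - c) *s u = (c * y - x) *s v"
      by (simp add: algebra_simps vector_sub_rdistrib vector_add_ldistrib)
    have "c = 1"
    proof (rule ccontr)
      assume "c \<noteq> 1"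
      then have "u = (inverse (1 - c)) *s ((1 - c) *s u)" by simp
      then have "u = (inverse (1 - c) * (c * y - x)) *s v" by (simp add: e)
      then show False using u v uv span_eq_span_iff by blast
    qed
    with e v show "x = y" by simp
  qed
  have W: "{P \<in> curve. P \<subseteq> vec.span {u, v}} = p ` X"
  proof (intro equalityI subsetI)
    fix P assume "P \<in> p ` X"
    then obtain x where x: "x \<in> X" "P = p x" by blast
    have "u + x *s v \<in> vec.span {u, v}" by (auto simp: in_span_pair intro: exI[of _ 1])
    then have "P \<subseteq> vec.span {u, v}" unfolding x p_def by (intro vec.span_minimal) auto
    with x nz show "P \<in> {P \<in> curve. P \<subseteq> vec.span {u, v}}"
      by (auto simp: p_def X_def span_in_curve simp del: h_add h_add_right)
  next
    fix P assume P: "P \<in> {P \<in> curve. P \<subseteq> vec.span {u, v}}"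
    then obtain w where w: "w \<noteq> 0" "P = vec.span {w}" by (auto simp: curve_def elim: pointE)
    then have "w \<in> vec.span {u, v}" using P vec.span_base[of w "{w}"] by auto
    then obtain a c where w': "w = a *s u + c *s v" by (auto simp: in_span_pair)
    have ww: "h w w = 0" using P w span_in_curve by auto
    have "a \<noteq> 0" using w w' ww v by auto
    define y where "y = u + (c / a) *s v"
    have aw: "w = a *s y" using \<open>a \<noteq> 0\<close> by (simp add: w' y_def vector_add_ldistrib)
    then have "P = p (c / a)"
      unfolding p_def w y_def[symmetric] using w nz[of "c / a"] span_eq_span_iff y_def by blast
    moreover have "h y y = 0" using ww \<open>a \<noteq> 0\<close> by (simp add: aw)
    then have "c / a \<in> X" by (simp only: X_def y_def mem_Collect_eq)
    ultimately show "P \<in> p ` X" by blast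
  qed
  have "x \<in> X \<longleftrightarrow> nm (d * x + b) = nm b - h u u * d" for x
  proof -
    have "nm (d * x + b) - (nm b - h u u * d) = d * h (u + x *s v) (u + x *s v)"
      using d by (simp add: nm_def d_def[symmetric] b_def[symmetric] algebra_simps)
        (simp add: b_def)
    then show ?thesis using d by (simp add: X_def eq_iff_diff_eq_0[of "nm _"] del: h_add h_add_right)
  qed
  then have X: "X = {x. nm (d * x + b) = nm b - h u u * d}" by blast
  have "bij_betw (\<lambda>x. d * x + b) X {z. nm z = nm b - h u u * d}"
    unfolding X by (intro bij_betw_byWitness[where f' = "\<lambda>z. (z - b) / d"]) (use d in auto)
  then have "card {P \<in> curve. P \<subseteq> vec.span {u, v}} = card {z. nm z = nm b - h u u * d}"
    unfolding W using \<open>inj p\<close> by (metis bij_betw_same_card card_image inj_on_subset top_greatest)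
  moreover have "vec.span {u, v} \<in> lines"
    using u v uv by (simp add: lines_def dim_span_pair del: vec.dim_span)
  ultimately show ?thesis
    unfolding tangent_def by (auto simp: card_norm_fiber_eq_1[simplified] d_def b_def)
qed

lemma adj_iff_gram:
  assumes "u \<noteq> 0" "v \<noteq> 0" "h v v \<noteq> 0"
  shows "adj curve (vec.span {u}) (vec.span {v}) \<longleftrightarrow>
    vec.span {u} \<noteq> vec.span {v} \<and> h u u * h v v = nm (h u v)"
  using tangent_iff_gram[OF assms] by (auto simp: adj_def line_through_span)

definition perp :: "'k ^ 3 \<Rightarrow> ('k ^ 3) set" where
  "perp p = {w. h w p = 0}"

lemma subspace_perp: "vec.subspace (perp p)"
  by (auto simp: perp_def vec.subspace_def)

lemma perp_proper: "p \<noteq> 0 \<Longrightarrow> perp p \<noteq> UNIV"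
  using nondegenerate[of p] h_sym[of p] unfolding perp_def by (metis (mono_tags, lifting) UNIV_I cj_0 mem_Collect_eq)

lemma span_subset_perp: "vec.span {v} \<subseteq> perp p \<longleftrightarrow> h v p = 0"
  unfolding perp_def using mem_span_singleton_self[of v] by (force simp: in_span_singleton)

lemma perp_isotropic_rep:
  assumes p: "p \<noteq> 0" "h p p = 0" and v: "h v p = 0" "h v v \<noteq> 0" and r: "h r p = 0"
  shows "\<exists>x y. r = x *s v + y *s p"
proof -
  have nz: "v \<noteq> 0" using v by auto
  have ne: "vec.span {v} \<noteq> vec.span {p}" using p v nz by (metis span_in_curve)
  have "line_through (vec.span {v}) (vec.span {p}) = perp p"
    by (rule line_through_eq_proper_subspace)
      (use p v nz ne subspace_perp perp_proper in \<open>auto simp: point_span span_subset_perp\<close>)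
  then have "perp p = vec.span {v, p}" by (simp add: line_through_span)
  moreover have "r \<in> perp p" using r by (simp add: perp_def)
  ultimately show ?thesis by (simp add: in_span_pair)
qed

text \<open>
  The Gram matrix of two vectors spanning a tangent line is singular. Its kernel is the point of
  contact \<open>p\<close>, and it is orthogonal to the whole line.
\<close>

lemma tangent_line_eq_perp:
  assumes "P \<in> points - curve" "Q \<in> points - curve" "adj curve P Q"
  shows "\<exists>p. p \<noteq> 0 \<and> h p p = 0 \<and> line_through P Q = perp p"
proof -
  obtain u where u: "u \<noteq> 0" "h u u \<noteq> 0" "P = vec.span {u}" using assms(1) by (rule off_curveE)
  obtain v where v: "v \<noteq> 0" "h v v \<noteq> 0" "Q = vec.span {v}" using assms(2) by (rule off_curveE)
  have PQ: "P \<noteq> Q" and gram: "h u u * h v v = nm (h u v)"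
    using assms(3) adj_iff_gram[of u v] u v by auto
  define p where "p = u + (- (h u v / h v v)) *s v"
  have "p \<noteq> 0"
  proof
    assume "p = 0"
    then have "u = (h u v / h v v) *s v" unfolding p_def by (simp add: eq_neg_iff_add_eq_0)
    then show False using u v PQ span_eq_span_iff by blast
  qed
  moreover have vp: "h v p = 0" using v by (simp add: p_def)
  moreover have up: "h u p = 0"
    using gram v by (simp add: p_def nm_def field_simps)
  moreover have "h p p = h u p + (- (h u v / h v v)) * h v p"
    by (subst (1) p_def) (simp only: h_add h_scale)
  then have "h p p = 0" using vp up by simp
  moreover have "line_through P Q = perp p"
    by (rule line_through_eq_proper_subspace)
      (use u v PQ up vp subspace_perp perp_proper[OF \<open>p \<noteq> 0\<close>] in \<open>auto simp: point_span span_subset_perp\<close>)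
  ultimately show ?thesis by blast
qed

lemma independent_triple_spans:
  fixes u v w z :: "'k ^ 3"
  assumes "u \<noteq> 0" "v \<noteq> 0" "vec.span {u} \<noteq> vec.span {v}" "w \<notin> vec.span {u, v}"
  shows "\<exists>a b c. z = a *s u + b *s v + c *s w"
proof -
  have "vec.dim {w, u, v} = 3"
    using assms(4) dim_span_pair[OF assms(1-3)] by (simp add: vec.dim_insert[of w])
  then have "z \<in> vec.span {w, u, v}"
    using vec.dim_eq_full[of "{w, u, v}"] by (simp add: card_cart_basis vec.dimension_def)
  then obtain c where "z - c *s w \<in> vec.span {u, v}" by (auto simp: vec.span_breakdown_eq[of z w])
  then obtain a b where "z - c *s w = a *s u + b *s v" by (auto simp: in_span_pair)
  then show ?thesis by (intro exI[of _ a] exI[of _ b] exI[of _ c]) (simp add: diff_eq_eq)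
qed

text \<open>
  Put \<open>e = x * cj y * n\<close>. The second equation says \<open>cj e = - e\<close>. Multiplied by a suitable monomial, each
  of the others becomes divisible by \<open>e\<close>, and the quotients are \<open>a (y - cj y) = e\<close>, \<open>a (cj x - x) = e\<close>
  and \<open>a (cj x y - x cj y) = e\<close>. The first two show that \<open>x + y\<close> is in \<open>F\<close>, the third that it is \<open>1\<close>.
\<close>

lemma sum_eq_1_of_triangle:
  fixes a x y n :: 'k
  assumes a: "a \<noteq> 0" and nz: "x \<noteq> 0" "y \<noteq> 0" "n \<noteq> 0"
    and st: "a * (n + cj n) + n * cj n = 0"
    and tt: "x * cj y * n + cj x * y * cj n = 0"
    and s: "a * (cj y * n + y * cj n) + y * cj y * n * cj n = 0"
    and t: "a * (cj x * cj n + x * n) + x * cj x * n * cj n = 0"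
  shows "x + y = 1"
proof -
  define X Y N where "X = cj x" and "Y = cj y" and "N = cj n"
  define e where "e = x * Y * n"
  have e: "e \<noteq> 0" using nz by (simp add: e_def Y_def)
  have e': "X * y * N = - e"
    using tt by (simp add: e_def X_def Y_def N_def eq_neg_iff_add_eq_0 add.commute)
  have "e * (a * (y - Y)) = e * e"
    using t e' e_def unfolding X_def[symmetric] N_def[symmetric] by algebra
  then have 1: "a * (y - Y) = e" using e by simp
  have "e * (a * (X - x)) = e * e"
    using s e' e_def unfolding Y_def[symmetric] N_def[symmetric] by algebra
  then have 2: "a * (X - x) = e" using e by simp
  have "e * (a * (X * y - x * Y)) = e * e"
    using st e' e_def unfolding N_def[symmetric] by algebra
  then have 3: "a * (X * y - x * Y) = e" using e by simp
  have "a * (X - x) = a * (y - Y)" using 1 2 by simp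
  then have "X - x = y - Y" using a by simp
  then have "a * (X - x) * (x + y - 1) = 0" using 2 3 by algebra
  then show ?thesis using 2 e by simp
qed

text \<open>
  As all products with \<open>u\<close> equal \<open>h u u\<close>, the vectors \<open>v\<close>, \<open>w\<close>, \<open>z\<close> differ from \<open>u\<close> by isotropic
  vectors \<open>s\<close>, \<open>t\<close>, \<open>r\<close> orthogonal to \<open>u\<close>. If \<open>r = x s + y t\<close>, the remaining adjacencies force
  \<open>x = 0\<close>, \<open>y = 0\<close> or \<open>x + y = 1\<close>, and each of these is a collinearity.
\<close>

lemma four_clique_collinear_normalized:
  assumes u: "h u u = a" "a \<noteq> 0"
    and uv: "h u v = a" "h v v = a" and uw: "h u w = a" "h w w = a" and uz: "h u z = a" "h z z = a"
    and vw: "nm (h v w) = a * a" and vz: "nm (h v z) = a * a" and wz: "nm (h w z) = a * a"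
    and ne: "vec.span {u} \<noteq> vec.span {v}"
  shows "w \<in> vec.span {u, v} \<or> z \<in> vec.span {u, v} \<or> z \<in> vec.span {u, w} \<or> z \<in> vec.span {v, w}"
proof (cases "w \<in> vec.span {u, v}")
  case False
  have nz: "u \<noteq> 0" "v \<noteq> 0" using u uv by auto
  have ra: "cj a = a" using u(1) by auto
  have sym: "h v u = a" "h w u = a" "h z u = a" using uv uw uz ra h_sym by metis+
  obtain c x y where z: "z = c *s u + x *s v + y *s w"
    using independent_triple_spans[OF nz ne, of w z] False by blast
  define s t where "s = v - u" and "t = w - u"
  define n where "n = h s t"
  have ss: "h s s = 0" "h t t = 0" "h u s = 0" "h u t = 0" "h s u = 0" "h t u = 0"
    by (simp_all add: s_def t_def u uv uw sym)
  have "h z u = (c + x + y) * a" by (simp add: z u sym algebra_simps)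
  then have cxy: "c + x + y = 1" using sym u(2) by simp
  have z': "z = u + (x *s s + y *s t)"
  proof -
    have "z = (c + x + y) *s u + (x *s s + y *s t)"
      by (simp add: z s_def t_def vec_eq_iff algebra_simps)
    then show ?thesis by (simp add: cxy)
  qed
  have v': "v = u + s" and w': "w = u + t" by (simp_all add: s_def t_def)
  have nt: "h t s = cj n" by (simp add: n_def)
  have st: "a * (n + cj n) + n * cj n = 0"
  proof -
    have "h v w = a + n" by (simp add: v' w' ss u n_def)
    then show ?thesis using vw ra by (simp add: nm_def algebra_simps)
  qed
  have tt: "x * cj y * n + cj x * y * cj n = 0"
    using uz(2) by (simp add: z' ss u nt n_def[symmetric] algebra_simps)
  have sz: "a * (cj y * n + y * cj n) + y * cj y * n * cj n = 0"
  proof -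
    have "h v z = a + cj y * n" by (simp add: v' z' ss u n_def)
    then show ?thesis using vz ra by (simp add: nm_def algebra_simps)
  qed
  have tz: "a * (cj x * cj n + x * n) + x * cj x * n * cj n = 0"
  proof -
    have "h w z = a + cj x * cj n" by (simp add: w' z' ss u nt)
    then show ?thesis using wz ra by (simp add: nm_def algebra_simps)
  qed
  have "n \<noteq> 0"
  proof
    assume "n = 0"
    have "h s r = 0" for r
    proof -
      obtain c x y where r: "r = c *s u + x *s v + y *s w"
        using independent_triple_spans[OF nz ne, of w r] False by blast
      show ?thesis using \<open>n = 0\<close> by (simp add: r v' w' ss n_def)
    qed
    then have "s = 0" by (rule nondegenerate)
    then show False using ne by (simp add: s_def)
  qed
  consider "x = 0" | "y = 0" | "x + y = 1"
    using sum_eq_1_of_triangle[OF u(2) _ _ \<open>n \<noteq> 0\<close> st tt sz tz] by blast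
  then show ?thesis
  proof cases
    case 1
    then show ?thesis by (auto simp: z in_span_pair)
  next
    case 2
    then show ?thesis by (auto simp: z in_span_pair)
  next
    case 3
    then have "c = 0" using cxy by (simp add: add.assoc)
    then show ?thesis by (auto simp: z in_span_pair)
  qed
qed simp

lemma normalize_neighbour:
  assumes u: "h u u = a" "a \<noteq> 0" and Q: "Q \<in> points - curve" "adj curve (vec.span {u}) Q"
  shows "\<exists>v. v \<noteq> 0 \<and> Q = vec.span {v} \<and> h u v = a \<and> h v v = a"
proof -
  obtain v where v: "v \<noteq> 0" "h v v \<noteq> 0" "Q = vec.span {v}" using Q(1) by (rule off_curveE)
  have "u \<noteq> 0" using u by auto
  then have gram: "a * h v v = nm (h u v)" using Q(2) v u(1) by (simp add: adj_iff_gram)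
  then have b: "h u v \<noteq> 0" using u(2) v(2) by (auto simp: nm_def)
  then have b': "h v u \<noteq> 0" by (metis cj_eq_0_iff cj_h)
  have ra: "cj a = a" using u(1) by auto
  define c where "c = a / h v u"
  have c: "c \<noteq> 0" using b' u(2) by (simp add: c_def)
  have "h u (c *s v) = a" using b b' ra by (simp add: c_def)
  moreover have "h (c *s v) (c *s v) = a"
    using b b' ra gram by (simp add: c_def nm_def field_simps)
  moreover have "Q = vec.span {c *s v}"
  proof -
    have "vec.span {c *s v} = vec.span {v}" using c v by (subst span_eq_span_iff) auto
    then show ?thesis using v by simp
  qed
  moreover have "c *s v \<noteq> 0" using c v by simp
  ultimately show ?thesis by blast
qed

text \<open>
  This is the absence of O'Nan configurations in the classical unital, read in the graph: four
  pairwise adjacent points always contain three collinear ones.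
\<close>

lemma four_clique_collinear:
  assumes "P \<in> points - curve" "Q \<in> points - curve" "R \<in> points - curve" "S \<in> points - curve"
    and "adj curve P Q" "adj curve P R" "adj curve P S"
    and "adj curve Q R" "adj curve Q S" "adj curve R S"
  shows "R \<subseteq> line_through P Q \<or> S \<subseteq> line_through P Q \<or>
    S \<subseteq> line_through P R \<or> S \<subseteq> line_through Q R"
proof -
  obtain u where u: "u \<noteq> 0" "h u u \<noteq> 0" "P = vec.span {u}" using assms(1) by (rule off_curveE)
  define a where "a = h u u"
  have a: "h u u = a" "a \<noteq> 0" using u by (simp_all add: a_def)
  obtain v where v: "v \<noteq> 0" "Q = vec.span {v}" "h u v = a" "h v v = a"
    using normalize_neighbour[OF a assms(2)] assms(5) u(3) by blast
  obtain w where w: "w \<noteq> 0" "R = vec.span {w}" "h u w = a" "h w w = a"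
    using normalize_neighbour[OF a assms(3)] assms(6) u(3) by blast
  obtain z where z: "z \<noteq> 0" "S = vec.span {z}" "h u z = a" "h z z = a"
    using normalize_neighbour[OF a assms(4)] assms(7) u(3) by blast
  have "nm (h v w) = a * a" "nm (h v z) = a * a" "nm (h w z) = a * a"
    using assms(8-10) v w z a(2) adj_iff_gram[of v w] adj_iff_gram[of v z] adj_iff_gram[of w z]
    by simp_all
  moreover have "vec.span {u} \<noteq> vec.span {v}" using assms(5) u v by (auto simp: adj_def)
  ultimately have "w \<in> vec.span {u, v} \<or> z \<in> vec.span {u, v} \<or> z \<in> vec.span {u, w} \<or> z \<in> vec.span {v, w}"
    using four_clique_collinear_normalized[OF a v(3,4) w(3,4) z(3,4)] by blast
  then show ?thesis
    unfolding u(3) v(2) w(2) z(2) line_through_span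
    using vec.span_minimal[OF _ vec.subspace_span] by (metis empty_subsetI insert_subset)
qed

lemma adj_of_isotropic_perp:
  assumes p: "p \<noteq> 0" "h p p = 0" and P: "P \<in> points - curve" "P \<subseteq> perp p"
    and Q: "Q \<in> points - curve" "Q \<subseteq> perp p" "P \<noteq> Q"
  shows "adj curve P Q"
proof -
  obtain u where u: "u \<noteq> 0" "h u u \<noteq> 0" "P = vec.span {u}" using P(1) by (rule off_curveE)
  obtain v where v: "v \<noteq> 0" "h v v \<noteq> 0" "Q = vec.span {v}" using Q(1) by (rule off_curveE)
  have up: "h u p = 0" "h v p = 0" using P Q u v span_subset_perp by auto
  then have pu: "h p u = 0" using h_sym[of p u] by simp
  obtain x y where "v = x *s u + y *s p" using perp_isotropic_rep[OF p up(1) u(2) up(2)] by blast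
  then have "h u u * h v v = nm (h u v)" using up pu p by (simp add: nm_def)
  then show ?thesis using adj_iff_gram[of u v] u v Q(3) by simp
qed

text \<open>
  On the line \<open>perp p\<close> the points other than \<open>p\<close> are \<open>u + t p\<close> with a common value of the form, so
  being adjacent to a fixed point off the line is an equation of degree \<open>q + 1\<close> in \<open>t\<close>.
\<close>

lemma card_neighbours_on_tangent_le:
  assumes p: "p \<noteq> 0" "h p p = 0" and A: "A \<in> points - curve" "\<not> A \<subseteq> perp p"
    and S: "S \<subseteq> points - curve" "\<And>P. P \<in> S \<Longrightarrow> P \<subseteq> perp p" "\<And>P. P \<in> S \<Longrightarrow> adj curve A P"
  shows "card S \<le> q + 1"
proof (cases "S = {}")
  case False
  obtain a where a: "a \<noteq> 0" "h a a \<noteq> 0" "A = vec.span {a}" using A(1) by (rule off_curveE)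
  have ap: "h a p \<noteq> 0" using A(2) a span_subset_perp by auto
  obtain P where "P \<in> S" using False by blast
  then obtain u where u: "u \<noteq> 0" "h u u \<noteq> 0" "P = vec.span {u}" using S(1) by (metis off_curveE subsetD)
  have up: "h u p = 0" using S(2)[OF \<open>P \<in> S\<close>] u span_subset_perp by auto
  then have pu: "h p u = 0" using h_sym[of p u] by simp
  define g where "g = (\<lambda>t. h a u + cj t * h a p)"
  define D where "D = h a a * h u u"
  have "S \<subseteq> (\<lambda>z. vec.span {u + cj ((z - h a u) / h a p) *s p}) ` {z. nm z = D}"
  proof
    fix R assume R: "R \<in> S"
    then obtain r where r: "r \<noteq> 0" "h r r \<noteq> 0" "R = vec.span {r}" using S(1) by (metis off_curveE subsetD)
    have "h r p = 0" using S(2)[OF R] r span_subset_perp by auto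
    then obtain x y where xy: "r = x *s u + y *s p" using perp_isotropic_rep[OF p up u(2)] by blast
    have x: "x \<noteq> 0" using xy r p by auto
    define t where "t = y / x"
    define w where "w = u + t *s p"
    have rw: "r = x *s w" using x by (simp add: xy w_def t_def vector_add_ldistrib)
    have w0: "w \<noteq> 0" using rw r by auto
    then have Rw: "R = vec.span {w}" using span_eq_span_iff[OF r(1) w0] rw r by blast
    have ww: "h w w = h u u" using up pu p by (simp add: w_def)
    have "h a a * h w w = nm (h a w)" using S(3)[OF R] adj_iff_gram[of a w] a w0 ww u Rw by simp
    moreover have aw: "h a w = h a u + cj t * h a p" by (simp add: w_def)
    ultimately have "nm (h a w) = D" by (simp add: D_def ww)
    moreover have "cj ((h a w - h a u) / h a p) = t" using ap by (simp add: aw)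
    ultimately show "R \<in> (\<lambda>z. vec.span {u + cj ((z - h a u) / h a p) *s p}) ` {z. nm z = D}"
      unfolding Rw by (intro image_eqI[of _ _ "h a w"]) (simp_all only: w_def mem_Collect_eq)
  qed
  then have "card S \<le> card {z. nm z = D}"
    by (rule surj_card_le[rotated]) simp
  then show ?thesis using card_norm_fiber_le[of D] by simp
qed simp

text \<open>
  By the four-point lemma a clique either lies on a line, or consists of points of one line and
  a single point off it. In the second case the off-line point has at most \<open>q + 1\<close> neighbours on
  the line, so the clique has at most \<open>q + 2\<close> members.
\<close>

lemma large_clique_on_tangent:
  assumes S: "S \<subseteq> points - curve" "card S \<ge> q + 3" "\<And>P Q. P \<in> S \<Longrightarrow> Q \<in> S \<Longrightarrow> P \<noteq> Q \<Longrightarrow> adj curve P Q"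
  shows "\<exists>p. p \<noteq> 0 \<and> h p p = 0 \<and> (\<forall>P\<in>S. P \<subseteq> perp p)"
proof -
  have pts: "P \<in> points" if "P \<in> S" for P using S(1) that by blast
  have pick: "\<exists>P\<in>S. P \<notin> set Ps" if "length Ps < card S" for Ps
    using card_length[of Ps] card_mono[of "set Ps" S] that by (meson List.finite_set leD le_less_trans subsetI)
  have four: "R \<subseteq> line_through P Q \<or> T \<subseteq> line_through P Q \<or> T \<subseteq> line_through P R \<or> T \<subseteq> line_through Q R"
    if "P \<in> S" "Q \<in> S" "R \<in> S" "T \<in> S" "P \<noteq> Q" "P \<noteq> R" "P \<noteq> T" "Q \<noteq> R" "Q \<noteq> T" "R \<noteq> T"
    for P Q R T
    using that S(1) by (intro four_clique_collinear S(3)) auto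
  obtain A where A: "A \<in> S" using pick[of "[]"] S(2) by auto
  obtain B where B: "B \<in> S" "B \<noteq> A" using pick[of "[A]"] S(2) by auto
  obtain C where C: "C \<in> S" "C \<noteq> A" "C \<noteq> B" using pick[of "[A, B]"] S(2) by auto
  obtain D where D: "D \<in> S" "D \<noteq> A" "D \<noteq> B" "D \<noteq> C" using pick[of "[A, B, C]"] S(2) q_gt_2 by auto
  have "\<exists>P\<in>S. \<exists>Q\<in>S. \<exists>R\<in>S. P \<noteq> Q \<and> P \<noteq> R \<and> Q \<noteq> R \<and> R \<subseteq> line_through P Q"
    using four[of A B C D] A B C D by metis
  then obtain P Q R where P: "P \<in> S" and Q: "Q \<in> S" and R: "R \<in> S"
    and ne: "P \<noteq> Q" "P \<noteq> R" "Q \<noteq> R" and "R \<subseteq> line_through P Q"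
    by blast
  define l where "l = line_through P Q"
  have on_l: "P \<subseteq> l" "Q \<subseteq> l" "R \<subseteq> l"
    using \<open>R \<subseteq> line_through P Q\<close> by (simp_all add: l_def subset_line_through)
  have l: "l \<in> lines" unfolding l_def using P Q ne pts line_through_in_lines by blast
  obtain p where p: "p \<noteq> 0" "h p p = 0" "l = perp p"
  proof -
    have "P \<in> points - curve" "Q \<in> points - curve" using S(1) P Q by blast+
    from tangent_line_eq_perp[OF this S(3)[OF P Q ne(1)]] that show thesis
      unfolding l_def by blast
  qed
  have "A \<subseteq> l" if A: "A \<in> S" for A
  proof (rule ccontr)
    assume A_l: "\<not> A \<subseteq> l"
    have "B \<subseteq> l" if B: "B \<in> S" "B \<noteq> A" for B
    proof (rule ccontr)
      assume B_l: "\<not> B \<subseteq> l"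
      \<comment> \<open>Only one of \<open>P\<close>, \<open>Q\<close>, \<open>R\<close> can lie on \<open>AB\<close>; the other two and \<open>A\<close>, \<open>B\<close> violate the four-point lemma.\<close>
      have not_two: "X = Y" if "X \<in> S" "Y \<in> S" "X \<subseteq> l" "Y \<subseteq> l"
        "X \<subseteq> line_through A B" "Y \<subseteq> line_through A B" for X Y
      proof (rule ccontr)
        assume "X \<noteq> Y"
        have "line_through X Y = l" "line_through X Y = line_through A B"
          using that \<open>X \<noteq> Y\<close> pts l A B by (intro line_through_eqI line_through_in_lines; simp)+
        then show False using A_l subset_line_through(1)[of A B] by simp
      qed
      have no_third: "\<not> Y \<subseteq> line_through Z X"
        if "X \<in> S" "Y \<in> S" "X \<subseteq> l" "Y \<subseteq> l" "X \<noteq> Y" "Z \<in> S" "\<not> Z \<subseteq> l" for X Y Z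
      proof
        assume "Y \<subseteq> line_through Z X"
        moreover have "Z \<noteq> X" using that by auto
        ultimately have "line_through X Y = line_through Z X"
          using that pts by (intro line_through_eqI line_through_in_lines subset_line_through) auto
        moreover have "line_through X Y = l" using that pts l by (intro line_through_eqI) auto
        ultimately show False using that subset_line_through(1)[of Z X] by simp
      qed
      have one: "X \<subseteq> line_through A B \<or> Y \<subseteq> line_through A B"
        if "X \<in> S" "Y \<in> S" "X \<subseteq> l" "Y \<subseteq> l" "X \<noteq> Y" for X Y
        using four[of A B X Y] A B that A_l B_l no_third[OF that A A_l] no_third[OF that B(1) B_l] by metis
      show False
        using one[OF P Q] one[OF P R] one[OF Q R] not_two[OF P Q] not_two[OF P R] not_two[OF Q R] on_l ne
        by blast
    qed
    then have "P \<subseteq> perp p" "adj curve A P" if "P \<in> S - {A}" for P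
      using that A S(3)[of A P] p(3) by auto
    then have "card (S - {A}) \<le> q + 1"
      using A A_l S(1) p by (intro card_neighbours_on_tangent_le[of p A]) blast+
    then show False using S(2) A by (simp add: card_Diff_singleton)
  qed
  then show ?thesis using p by blast
qed

text \<open>
  A large clique lies on a tangent line \<open>perp p\<close>. The elation \<open>v \<mapsto> v + c h(v,p) p\<close> with \<open>cj c = - c\<close>
  is an isometry that fixes this line pointwise, so it preserves adjacency to the clique. A point
  off the line and its image span a line through \<open>p\<close> other than the tangent, so they are not
  adjacent.
\<close>

lemma elation_property_curve: "elation_property (q + 3) (points - curve) (adj curve)"
  unfolding elation_property_def
proof (intro allI impI, elim conjE bexE)
  fix S P R
  assume S: "S \<subseteq> points - curve" "q + 3 \<le> card S" "\<forall>Q\<in>S. \<forall>R\<in>S. Q \<noteq> R \<longrightarrow> adj curve Q R"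
    and P: "P \<in> points - curve - S" and R: "R \<in> S" "\<not> adj curve P R"
  obtain p where p: "p \<noteq> 0" "h p p = 0" and Sp: "\<And>Q. Q \<in> S \<Longrightarrow> Q \<subseteq> perp p"
  proof -
    have "adj curve Q R" if "Q \<in> S" "R \<in> S" "Q \<noteq> R" for Q R using S(3) that by blast
    from large_clique_on_tangent[OF S(1,2) this] that show thesis by blast
  qed
  obtain v where v: "v \<noteq> 0" "h v v \<noteq> 0" "P = vec.span {v}"
    using P by (metis DiffD1 off_curveE)
  have "\<not> P \<subseteq> perp p"
    using adj_of_isotropic_perp[OF p, of P R] S(1) P R Sp by blast
  then have vp: "h v p \<noteq> 0" using v span_subset_perp by simp
  then have pv: "h p v \<noteq> 0" by (metis cj_eq_0_iff cj_h)
  obtain w where w: "cj w \<noteq> w" using not_in_F by blast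
  define c where "c = w - cj w"
  have c: "c \<noteq> 0" "cj c = - c" using w by (auto simp: c_def)
  define v' where "v' = v + (c * h v p) *s p"
  have v'p: "h v' p = h v p" by (simp add: v'_def p)
  then have v'0: "v' \<noteq> 0" using vp by auto
  have v'v': "h v' v' = h v v" by (simp add: v'_def p c algebra_simps)
  define P' where "P' = vec.span {v'}"
  have P': "P' \<in> points - curve" using v'0 v'v' v by (simp add: P'_def point_span span_in_curve)
  have P'S: "P' \<notin> S" using Sp[of P'] v'p vp by (auto simp: P'_def span_subset_perp)
  have not_gram: "h v v * h v' v' \<noteq> nm (h v v')"
  proof -
    have "h v v' = h v v - c * (h p v * h v p)" by (simp add: v'_def c algebra_simps)
    moreover have "cj (h v v') = h v v + c * (h p v * h v p)" by (simp add: v'_def)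
    ultimately have "nm (h v v') = (h v v - c * (h p v * h v p)) * (h v v + c * (h p v * h v p))"
      unfolding nm_def by (simp only:)
    then have "nm (h v v') = h v v * h v v - (c * (h p v * h v p)) ^ 2"
      by (simp add: power2_eq_square algebra_simps)
    then show ?thesis using v'v' c vp pv by simp
  qed
  show "\<exists>P'\<in>points - curve - S. P' \<noteq> P \<and> \<not> adj curve P P' \<and> (\<forall>R\<in>S. adj curve P R \<longrightarrow> adj curve P' R)"
  proof (intro bexI[of _ P'] conjI ballI impI)
    show "P' \<noteq> P" using gram_eq_of_span_eq[of v v'] not_gram v v'0 by (auto simp: P'_def)
    show "\<not> adj curve P P'" using not_gram adj_iff_gram[of v v'] v v'0 v'v' by (simp add: P'_def)
    show "P' \<in> points - curve - S" using P' P'S by simp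
    fix R assume R: "R \<in> S" "adj curve P R"
    then obtain r where r: "r \<noteq> 0" "h r r \<noteq> 0" "R = vec.span {r}" using S(1) by (metis off_curveE subsetD)
    have rp: "h r p = 0" using Sp[OF R(1)] r span_subset_perp by simp
    then have pr: "h p r = 0" by (metis cj_0 cj_h)
    have "h v r = h v' r" by (simp add: v'_def pr)
    then show "adj curve P' R"
      using R P'S r v v'v' v'0 adj_iff_gram[of v r] adj_iff_gram[of v' r] unfolding P'_def by metis
  qed
qed

text \<open>
  A form with these properties is given by its Gram matrix in the standard basis. This direction
  turns explicit forms into Hermitian curves without exhibiting the matrix.
\<close>

lemma hermitian_curve_curve: "hermitian_curve q curve"
proof -
  define A :: "'k ^ 3 ^ 3" where "A = (\<chi> i j. h (axis i 1) (axis j 1))"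
  have form: "hermitian_form q A v w = h v w" for v w
  proof -
    have h_sum: "h (sum f UNIV) w = (\<Sum>i\<in>UNIV. h (f i) w)" for f :: "3 \<Rightarrow> 'k ^ 3" and w
      by (simp add: sum_3)
    have h_sum_right: "h w (sum f UNIV) = (\<Sum>i\<in>UNIV. h w (f i))" for f :: "3 \<Rightarrow> 'k ^ 3" and w
      by (simp add: sum_3)
    have "h v w = h (\<Sum>i\<in>UNIV. v $ i *s axis i 1) (\<Sum>j\<in>UNIV. w $ j *s axis j 1)"
      by (simp only: basis_expansion)
    also have "\<dots> = hermitian_form q A v w"
      by (simp add: h_sum h_sum_right hermitian_form_def A_def cj_def[symmetric] sum_distrib_left mult_ac)
        (rule sum.swap)
    finally show ?thesis by simp
  qed
  have "x = 0" if "A *v x = 0" for x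
  proof -
    define v :: "'k ^ 3" where "v = (\<chi> i. cj (x $ i))"
    have "h w v = 0" for w
    proof -
      have "h w v = (\<Sum>i\<in>UNIV. w $ i * (A *v x) $ i)"
        by (simp add: form[symmetric] hermitian_form_def matrix_vector_mult_def v_def
          cj_def[symmetric] sum_distrib_left mult_ac)
      then show ?thesis using that by simp
    qed
    then have "h v w = 0" for w using h_sym[of v w] by simp
    then have "v = 0" by (rule nondegenerate)
    then show "x = 0" by (simp add: v_def vec_eq_iff)
  qed
  then have "\<exists>B. B ** A = mat 1" by (simp add: matrix_left_invertible_ker)
  then have inv: "invertible A" by (simp add: invertible_left_inverse)
  have sym: "A $ j $ i = (A $ i $ j) ^ q" for i j
  proof -
    have "A $ j $ i = cj (A $ i $ j)" by (simp add: A_def)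
    then show ?thesis by (simp only: cj_def)
  qed
  have "unitary_polarity q (\<lambda>S. {v. \<forall>w\<in>S. h v w = 0})"
    unfolding unitary_polarity_def
  proof (intro exI[of _ A] conjI allI impI)
    show "A $ j $ i = (A $ i $ j) ^ q" for i j by (rule sym)
  qed (simp_all only: form inv)
  moreover have "curve = {P \<in> points. P \<subseteq> {v. \<forall>w\<in>P. h v w = 0}}"
    by (auto simp: curve_def)
  ultimately show ?thesis unfolding hermitian_curve_def by blast
qed

end

context quadratic_field
begin

lemma hermitian_curve_imp_plane:
  fixes H :: "('k ^ 3) set set"
  assumes "hermitian_curve q H"
  shows "\<exists>h. hermitian_plane q h \<and> H = hermitian_plane.curve h"
proof -
  obtain \<rho> where \<rho>: "unitary_polarity q \<rho>" "H = {P \<in> points. P \<subseteq> \<rho> P}"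
    using assms unfolding hermitian_curve_def by blast
  obtain A :: "'k ^ 3 ^ 3" where A: "invertible A" "\<And>i j. A $ j $ i = (A $ i $ j) ^ q"
    and \<rho>_eq: "\<And>S. vec.subspace S \<Longrightarrow> \<rho> S = {v. \<forall>w\<in>S. hermitian_form q A v w = 0}"
    using \<rho>(1) unfolding unitary_polarity_def by blast
  define h where "h = hermitian_form q A"
  have h: "h v w = (\<Sum>i\<in>UNIV. \<Sum>j\<in>UNIV. v $ i * A $ i $ j * cj (w $ j))" for v w
    by (simp add: h_def hermitian_form_def cj_def)
  have sym: "h w v = cj (h v w)" for v w
  proof -
    have "cj (h v w) = (\<Sum>i\<in>UNIV. \<Sum>j\<in>UNIV. w $ j * A $ j $ i * cj (v $ i))"
    proof -
      have "cj (v $ i * A $ i $ j * cj (w $ j)) = w $ j * A $ j $ i * cj (v $ i)" for i j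
        using A(2)[of j i, folded cj_def] by simp
      then show ?thesis by (simp only: h cj_sum)
    qed
    also have "\<dots> = h w v" unfolding h by (rule sum.swap)
    finally show ?thesis by simp
  qed
  interpret hermitian_plane q field_type h
  proof unfold_locales
    fix u v w :: "'k ^ 3" and a :: 'k
    show "h (u + v) w = h u w + h v w" by (simp add: h sum.distrib algebra_simps)
    show "h (a *s u) w = a * h u w" by (simp add: h sum_distrib_left mult_ac)
    show "h w u = cj (h u w)" by (rule sym)
    assume 0: "\<And>w. h v w = 0"
    define x :: "'k ^ 3" where "x = (\<chi> i. cj (v $ i))"
    have "(A *v x) $ i = 0" for i
    proof -
      have "(A *v x) $ i = h (axis i 1) v"
      proof -
        have "h (axis i 1) v = (\<Sum>k\<in>UNIV. if k = i then \<Sum>j\<in>UNIV. A $ k $ j * cj (v $ j) else 0)"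
          unfolding h by (intro sum.cong) (auto simp: axis_def)
        then show ?thesis by (simp add: matrix_vector_mult_def x_def)
      qed
      also have "\<dots> = 0" using 0 by (subst sym) simp
      finally show ?thesis .
    qed
    then have "A *v x = 0" by (simp add: vec_eq_iff)
    then have "x = 0" using A(1) by (metis invertible_def matrix_left_invertible_ker)
    then show "v = 0" by (simp add: x_def vec_eq_iff)
  qed
  have "H = curve"
    unfolding \<rho>(2) curve_def using \<rho>_eq by (auto simp: points_def h_def)
  then show ?thesis using hermitian_plane_axioms by blast
qed

lemma hermitian_curve_elation_property:
  fixes H :: "('k ^ 3) set set"
  assumes "hermitian_curve q H"
  shows "elation_property (q + 3) (points - H) (adj H)"
  using hermitian_curve_imp_plane[OF assms] hermitian_plane.elation_property_curve by blast

lemma matrix_image_span: "(*v) M ` vec.span {v} = vec.span {M *v v}"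
  for M :: "'k ^ 3 ^ 3"
  by (simp add: vec.span_image[symmetric])

lemma points_matrix_image:
  fixes M :: "'k ^ 3 ^ 3"
  assumes "invertible M"
  shows "(\<lambda>P. (*v) M ` P) ` points = points"
proof -
  have sub: "(\<lambda>P. (*v) M ` P) ` points \<subseteq> points" if "invertible M" for M :: "'k ^ 3 ^ 3"
  proof -
    have nz: "M *v v \<noteq> 0" if "v \<noteq> 0" for v
      using \<open>invertible M\<close> that by (metis invertible_def matrix_left_invertible_ker)
    then have "(*v) M ` P \<in> points" if P: "P \<in> points" for P
    proof -
      obtain v where "v \<noteq> 0" "P = vec.span {v}" using P by (rule pointE)
      with nz show ?thesis by (simp add: matrix_image_span point_span)
    qed
    then show ?thesis by blast
  qed
  obtain N where N: "M ** N = mat 1" "N ** M = mat 1" using assms by (auto simp: invertible_def)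
  have "P \<in> (\<lambda>P. (*v) M ` P) ` points" if "P \<in> points" for P
  proof
    show "P = (*v) M ` (*v) N ` P" by (simp add: image_image matrix_vector_mul_assoc N)
    have "invertible N" using N by (auto simp: invertible_def)
    from sub[OF this] that show "(*v) N ` P \<in> points" by blast
  qed
  with sub[OF assms] show ?thesis by blast
qed

lemma hermitian_curve_proj_equiv:
  fixes U V :: "('k ^ 3) set set"
  assumes V: "hermitian_curve q V" and VU: "proj_equiv V U"
  shows "hermitian_curve q U"
proof -
  obtain M :: "'k ^ 3 ^ 3" where M: "invertible M" "U = (\<lambda>P. (*v) M ` P) ` V"
    using VU by (auto simp: proj_equiv_def)
  obtain N where N: "M ** N = mat 1" "N ** M = mat 1" using M by (auto simp: invertible_def)
  have NM: "N *v (M *v v) = v" "M *v (N *v v) = v" for v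
    by (simp_all add: matrix_vector_mul_assoc N)
  obtain h where "hermitian_plane q h" and V_eq: "V = hermitian_plane.curve h"
    using hermitian_curve_imp_plane[OF V] by blast
  then interpret h: hermitian_plane q field_type h by simp
  interpret g: hermitian_plane q field_type "\<lambda>v w. h (N *v v) (N *v w)"
  proof unfold_locales
    fix u v w :: "'k ^ 3" and a :: 'k
    show "h (N *v (u + v)) (N *v w) = h (N *v u) (N *v w) + h (N *v v) (N *v w)"
      by (simp add: vec.add)
    show "h (N *v (a *s u)) (N *v w) = a * h (N *v u) (N *v w)"
      by (simp add: vec.scale)
    show "h (N *v w) (N *v u) = cj (h (N *v u) (N *v w))" by simp
    assume 0: "\<And>w. h (N *v v) (N *v w) = 0"
    have "h (N *v v) w = 0" for w using 0[of "M *v w"] by (simp add: NM)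
    then have "N *v v = 0" by (rule h.nondegenerate)
    then show "v = 0" using NM(2)[of v] by simp
  qed
  have "U = g.curve"
  proof -
    have "U = (\<lambda>P. (*v) M ` P) ` {P \<in> points. \<forall>v\<in>P. \<forall>w\<in>P. h v w = 0}"
      by (simp add: M V_eq h.curve_def)
    also have "\<dots> = {P \<in> (\<lambda>P. (*v) M ` P) ` points. \<forall>v\<in>P. \<forall>w\<in>P. h (N *v v) (N *v w) = 0}"
      by (auto simp: NM)
    finally show ?thesis by (simp add: points_matrix_image[OF M(1)] g.curve_def)
  qed
  then show ?thesis using g.hermitian_curve_curve by simp
qed

text \<open>A projectivity carries tangent lines to tangent lines.\<close>

lemma elation_property_proj_equiv:
  fixes U V :: "('k ^ 3) set set"
  assumes VU: "proj_equiv V U" and U: "elation_property n (points - U) (adj U)" and V: "V \<subseteq> points"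
  shows "elation_property n (points - V) (adj V)"
proof -
  obtain M :: "'k ^ 3 ^ 3" where M: "invertible M" and U_eq: "U = (\<lambda>P. (*v) M ` P) ` V"
    using VU by (auto simp: proj_equiv_def)
  have inj: "inj ((*v) M)" using M by (metis invertible_def matrix_left_invertible_injective)
  then have injI: "inj (\<lambda>P. (*v) M ` P)" by (simp add: inj_image_eq_iff inj_def)
  have "bij_betw (\<lambda>P. (*v) M ` P) (points - V) (points - U)"
    unfolding bij_betw_def U_eq
    using injI by (auto simp: image_set_diff points_matrix_image[OF M] intro: inj_on_subset)
  moreover have "adj V P Q \<longleftrightarrow> adj U ((*v) M ` P) ((*v) M ` Q)" if "P \<in> points" "Q \<in> points" for P Q
  proof -
    have l: "line_through ((*v) M ` P) ((*v) M ` Q) = (*v) M ` line_through P Q"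
      unfolding line_through_def by (simp add: vec.span_image flip: image_Un)
    have "{R \<in> U. R \<subseteq> (*v) M ` line_through P Q} = (\<lambda>P. (*v) M ` P) ` {R \<in> V. R \<subseteq> line_through P Q}"
      unfolding U_eq by (auto simp: inj_image_subset_iff[OF inj])
    then have "card {R \<in> U. R \<subseteq> (*v) M ` line_through P Q} = card {R \<in> V. R \<subseteq> line_through P Q}"
      using injI by (simp add: card_image inj_on_subset)
    moreover have "(*v) M ` P \<in> points" "(*v) M ` Q \<in> points"
      using points_matrix_image[OF M] that by blast+
    ultimately show ?thesis
      unfolding adj_def tangent_def
      using that line_through_in_lines[of P Q] line_through_in_lines[of "(*v) M ` P" "(*v) M ` Q"]
      by (auto simp: l inj_image_eq_iff[OF inj])
  qed
  ultimately show ?thesis using U by (rule elation_property_iso) auto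
qed

end

section \<open>Sets of points given by one affine equation\<close>

lemma vector_3_eq_0_iff: "vector [x, y, z] = (0 :: 'k::{field,finite} ^ 3) \<longleftrightarrow> x = 0 \<and> y = 0 \<and> z = 0"
  by (auto simp: vec_eq_iff forall_3 vector_3)

lemma pt_in_points: "x \<noteq> 0 \<or> y \<noteq> 0 \<or> z \<noteq> 0 \<Longrightarrow> pt x y z \<in> points"
  by (auto simp: pt_def vector_3_eq_0_iff intro!: point_span)

lemma pt_eq_iff:
  assumes "x \<noteq> 0 \<or> y \<noteq> 0 \<or> z \<noteq> 0" "x' \<noteq> 0 \<or> y' \<noteq> 0 \<or> z' \<noteq> 0"
  shows "pt x y z = pt x' y' z' \<longleftrightarrow> (\<exists>c. x = c * x' \<and> y = c * y' \<and> z = c * z')"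
  unfolding pt_def using assms
  by (subst span_eq_span_iff) (auto simp: vector_3_eq_0_iff vec_eq_iff forall_3 vector_3)

lemma pt_cases:
  assumes "P \<in> points"
  obtains x y where "P = pt x y 1" | m where "P = pt 1 m 0" | "P = pt 0 1 0"
proof -
  obtain v where v: "v \<noteq> 0" "P = vec.span {v}" using assms by (rule pointE)
  have vec: "v = vector [v $ 1, v $ 2, v $ 3]" by (simp add: vec_eq_iff forall_3 vector_3)
  then have P: "P = pt (v $ 1) (v $ 2) (v $ 3)" using v by (simp add: pt_def)
  have nz: "v $ 1 \<noteq> 0 \<or> v $ 2 \<noteq> 0 \<or> v $ 3 \<noteq> 0" using v vec by (metis vector_3_eq_0_iff)
  consider "v $ 3 \<noteq> 0" | "v $ 3 = 0" "v $ 1 \<noteq> 0" | "v $ 3 = 0" "v $ 1 = 0" by blast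
  then show thesis
  proof cases
    case 1
    then have "P = pt (v $ 1 / v $ 3) (v $ 2 / v $ 3) 1"
      unfolding P by (subst pt_eq_iff) (auto intro: exI[of _ "v $ 3"])
    then show thesis by (rule that(1))
  next
    case 2
    then have "P = pt 1 (v $ 2 / v $ 1) 0"
      unfolding P by (subst pt_eq_iff) (auto intro: exI[of _ "v $ 1"])
    then show thesis by (rule that(2))
  next
    case 3
    then have "P = pt 0 1 0" using nz unfolding P by (subst pt_eq_iff) auto
    then show thesis by (rule that(3))
  qed
qed

definition line_graph :: "'k::{field,finite} \<Rightarrow> 'k \<Rightarrow> ('k ^ 3) set" where
  "line_graph m k = {w. w $ 2 = m * w $ 1 + k * w $ 3}"

definition line_vertical :: "'k::{field,finite} \<Rightarrow> ('k ^ 3) set" where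
  "line_vertical a = {w. w $ 1 = a * w $ 3}"

definition line_infinity :: "('k::{field,finite} ^ 3) set" where
  "line_infinity = {w. w $ 3 = 0}"

lemma subspace_affine_lines:
  "vec.subspace (line_graph m k)" "vec.subspace (line_vertical a)" "vec.subspace line_infinity"
  by (auto simp: vec.subspace_def line_graph_def line_vertical_def line_infinity_def algebra_simps)

lemma affine_lines_proper:
  "line_graph m k \<noteq> UNIV" "line_vertical a \<noteq> UNIV" "line_infinity \<noteq> UNIV"
proof -
  have "vector [0, 1, 0] \<notin> line_graph m k" "vector [1, 0, 0] \<notin> line_vertical a"
    "vector [0, 0, 1] \<notin> line_infinity"
    by (simp_all add: line_graph_def line_vertical_def line_infinity_def vector_3)
  then show "line_graph m k \<noteq> UNIV" "line_vertical a \<noteq> UNIV" "line_infinity \<noteq> UNIV" by blast+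
qed

lemma pt_subset_iff:
  assumes "vec.subspace S"
  shows "pt x y z \<subseteq> S \<longleftrightarrow> vector [x, y, z] \<in> S"
proof
  show "pt x y z \<subseteq> S \<Longrightarrow> vector [x, y, z] \<in> S"
    unfolding pt_def using mem_span_singleton_self by blast
  show "vector [x, y, z] \<in> S \<Longrightarrow> pt x y z \<subseteq> S"
    unfolding pt_def using assms by (intro vec.span_minimal) auto
qed

lemma pt_subset_affine_lines:
  "pt x y z \<subseteq> line_graph m k \<longleftrightarrow> y = m * x + k * z"
  "pt x y z \<subseteq> line_vertical a \<longleftrightarrow> x = a * z"
  "pt x y z \<subseteq> line_infinity \<longleftrightarrow> z = 0"
  by (simp_all only: pt_subset_iff subspace_affine_lines)
    (simp_all add: line_graph_def line_vertical_def line_infinity_def vector_3)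

lemma adj_on_proper_subspace:
  assumes "P \<in> points" "Q \<in> points" "P \<noteq> Q" "P \<subseteq> S" "Q \<subseteq> S" "vec.subspace S" "S \<noteq> UNIV"
  shows "adj U P Q \<longleftrightarrow> card {R \<in> U. R \<subseteq> S} = 1"
  using line_through_eq_proper_subspace[OF assms] line_through_in_lines[OF assms(1-3)] assms(3)
  by (simp add: adj_def tangent_def)

context quadratic_field
begin

text \<open>
  Every Buekenhout unital is equivalent to such a set with \<open>cj (\<Phi> x) = - \<Phi> x\<close>: adding an element of
  \<open>F\<close> to \<open>y\<close> does not change \<open>y - cj y\<close>, and the values of this expression are exactly the
  elements of trace zero.
\<close>

definition affine_curve :: "('k \<Rightarrow> 'k) \<Rightarrow> ('k ^ 3) set set" where
  "affine_curve \<Phi> = {pt x y 1 | x y. y - cj y = \<Phi> x} \<union> {pt 0 1 0}"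

lemma pt_in_affine_curve:
  "pt x y 1 \<in> affine_curve \<Phi> \<longleftrightarrow> y - cj y = \<Phi> x"
  "pt 1 m 0 \<in> affine_curve \<Phi> \<longleftrightarrow> False"
  "pt 0 1 0 \<in> affine_curve \<Phi>"
  by (auto simp: affine_curve_def pt_eq_iff)

lemma affine_curve_subset_points: "affine_curve \<Phi> \<subseteq> points"
  by (auto simp: affine_curve_def pt_in_points)

lemma adj_line_graph:
  assumes "P \<in> points" "Q \<in> points" "P \<noteq> Q" "P \<subseteq> line_graph m k" "Q \<subseteq> line_graph m k"
  shows "adj (affine_curve \<Phi>) P Q \<longleftrightarrow> card {x. m * x + k - cj (m * x + k) = \<Phi> x} = 1"
proof -
  have "{R \<in> affine_curve \<Phi>. R \<subseteq> line_graph m k} =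
      (\<lambda>x. pt x (m * x + k) 1) ` {x. m * x + k - cj (m * x + k) = \<Phi> x}"
    (is "?L = ?R")
  proof
    show "?L \<subseteq> ?R" unfolding affine_curve_def by (auto simp: pt_subset_affine_lines)
    show "?R \<subseteq> ?L"
    proof
      fix R assume "R \<in> ?R"
      then obtain x where "R = pt x (m * x + k) 1" "m * x + k - cj (m * x + k) = \<Phi> x" by blast
      then show "R \<in> ?L" by (simp add: pt_in_affine_curve pt_subset_affine_lines)
    qed
  qed
  moreover have "inj (\<lambda>x. pt x (m * x + k) 1)" by (auto simp: inj_def pt_eq_iff)
  ultimately have "card {R \<in> affine_curve \<Phi>. R \<subseteq> line_graph m k} =
      card {x. m * x + k - cj (m * x + k) = \<Phi> x}"
    by (simp add: card_image inj_on_subset)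
  then show ?thesis
    using adj_on_proper_subspace[OF assms subspace_affine_lines(1) affine_lines_proper(1)] by simp
qed

lemma adj_line_infinity:
  assumes "P \<in> points" "Q \<in> points" "P \<noteq> Q" "P \<subseteq> line_infinity" "Q \<subseteq> line_infinity"
  shows "adj (affine_curve \<Phi>) P Q"
proof -
  have "{R \<in> affine_curve \<Phi>. R \<subseteq> line_infinity} = {pt 0 1 0}"
    (is "?L = ?R")
  proof
    show "?L \<subseteq> ?R" unfolding affine_curve_def by (auto simp: pt_subset_affine_lines)
    show "?R \<subseteq> ?L" by (simp add: pt_in_affine_curve pt_subset_affine_lines)
  qed
  then show ?thesis
    using adj_on_proper_subspace[OF assms subspace_affine_lines(3) affine_lines_proper(3)] by simp
qed

lemma not_adj_line_vertical:
  assumes "P \<in> points" "Q \<in> points" "P \<noteq> Q" "P \<subseteq> line_vertical a" "Q \<subseteq> line_vertical a"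
    and \<Phi>: "cj (\<Phi> a) = - \<Phi> a"
  shows "\<not> adj (affine_curve \<Phi>) P Q"
proof -
  obtain y where y: "y - cj y = \<Phi> a" using trace_zero_eq_image[OF \<Phi>] by blast
  let ?T = "{R \<in> affine_curve \<Phi>. R \<subseteq> line_vertical a}"
  have "pt a y 1 \<in> ?T" "pt 0 1 0 \<in> ?T" using y by (auto simp: pt_in_affine_curve pt_subset_affine_lines)
  moreover have "pt a y 1 \<noteq> pt 0 1 0" by (auto simp: pt_eq_iff)
  ultimately have "card ?T \<noteq> 1" by (metis (no_types, lifting) card_1_singletonE singletonD)
  then show ?thesis
    using adj_on_proper_subspace[OF assms(1-5) subspace_affine_lines(2) affine_lines_proper(2)] by simp
qed

text \<open>
  The clique is the tangent line \<open>y = 0\<close> and the point \<open>P\<close> is the point of slope \<open>c\<close> at infinity. Its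
  partner \<open>P'\<close> is adjacent to the point at infinity of the clique but not to \<open>P\<close>, so it is an
  affine point \<open>(x', e)\<close> with \<open>e\<close> in \<open>F\<close>. The tangents \<open>y = c x + k\<close> through \<open>P\<close> meet the clique in
  the points \<open>(- k / c, 0)\<close>, and the line joining such a point to \<open>P'\<close> has slope \<open>e c / z\<close> with
  \<open>z = c x' + k\<close>. The conclusion says that all these lines are tangent.
\<close>

lemma elation_property_affine_curve:
  assumes trace: "\<And>x. cj (\<Phi> x) = - \<Phi> x" "\<And>m. cj (\<Psi> m) = - \<Psi> m"
    and aniso: "\<And>x. \<Phi> x = 0 \<longleftrightarrow> x = 0" "\<And>m. \<Psi> m = 0 \<longleftrightarrow> m = 0"
    and tangents: "\<And>m k. card {x. m * x + k - cj (m * x + k) = \<Phi> x} = 1 \<longleftrightarrow> k - cj k = \<Psi> m"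
    and el: "elation_property (q + 3) (points - affine_curve \<Phi>) (adj (affine_curve \<Phi>))"
    and c: "c \<noteq> 0"
  shows "\<exists>e x'. e \<noteq> 0 \<and> cj e = e \<and>
    (\<forall>z. z - cj z = \<Psi> c + (c * x' - cj (c * x')) \<longrightarrow>
       z \<noteq> 0 \<and> - (x' * (e * c / z)) + cj (x' * (e * c / z)) = \<Psi> (e * c / z))"
proof -
  let ?U = "affine_curve \<Phi>"
  define S where "S = {P \<in> points - ?U. P \<subseteq> line_graph 0 0}"
  define P where "P = pt 1 c 0"
  have adj_graph: "adj ?U Q R \<longleftrightarrow> k - cj k = \<Psi> m"
    if "Q \<in> points" "R \<in> points" "Q \<noteq> R" "Q \<subseteq> line_graph m k" "R \<subseteq> line_graph m k" for Q R m k
    using adj_line_graph[OF that] tangents by simp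
  have P: "P \<in> points - ?U - S"
    using c by (simp add: P_def S_def pt_in_points pt_in_affine_curve pt_subset_affine_lines)
  have axis_in_S: "pt x 0 1 \<in> S" if "x \<noteq> 0" for x
    using that aniso(1)[of x] by (simp add: S_def pt_in_points pt_in_affine_curve pt_subset_affine_lines)
  have clique: "adj ?U Q R" if "Q \<in> S" "R \<in> S" "Q \<noteq> R" for Q R
    using that adj_graph[of Q R 0 0] aniso(2)[of 0] by (simp add: S_def)
  have card_S: "q + 3 \<le> card S"
  proof -
    have "3 * q \<le> q * q" using q_gt_2 by simp
    then have "q + 3 \<le> q ^ 2 - 1" using q_gt_2 unfolding power2_eq_square by linarith
    also have "\<dots> = card (UNIV - {0 :: 'k})" by (simp add: card_Diff_singleton card_k)
    also have "\<dots> = card ((\<lambda>x. pt x 0 1) ` (UNIV - {0 :: 'k}))"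
      by (rule card_image[symmetric]) (auto simp: inj_on_def pt_eq_iff)
    also have "\<dots> \<le> card S" using axis_in_S by (intro card_mono) auto
    finally show ?thesis .
  qed
  have non_nbr: "\<exists>R\<in>S. \<not> adj ?U P R"
  proof (rule ccontr)
    assume "\<not> ?thesis"
    then have "adj ?U P (pt x 0 1)" if "x \<noteq> 0" for x using that axis_in_S by blast
    moreover have "adj ?U P (pt x 0 1) \<longleftrightarrow> - (c * x) - cj (- (c * x)) = \<Psi> c" for x
      unfolding P_def
      by (rule adj_graph) (auto simp: pt_in_points pt_eq_iff pt_subset_affine_lines)
    ultimately have "- (c * x) - cj (- (c * x)) = \<Psi> c" if "x \<noteq> 0" for x using that by blast
    moreover have "x = - (- (c * x) / c)" for x using c by simp
    ultimately have "UNIV - {0} \<subseteq> (\<lambda>k. - (k / c)) ` {k. k - cj k = \<Psi> c}"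
      by (intro subsetI image_eqI[of _ _ "- (c * x)" for x]) blast+
    then have "card (UNIV - {0 :: 'k}) \<le> card {k. k - cj k = \<Psi> c}" by (rule surj_card_le[rotated]) simp
    also have "\<dots> = q" using card_fiber trace(2) by simp
    finally have "q ^ 2 - 1 \<le> q" by (simp add: card_Diff_singleton card_k)
    moreover have "3 * q \<le> q ^ 2" using q_gt_2 by (simp add: power2_eq_square)
    ultimately show False using q_gt_2 by linarith
  qed
  have "S \<subseteq> points - ?U" by (auto simp: S_def)
  then have "\<exists>P'\<in>points - ?U - S. P' \<noteq> P \<and> \<not> adj ?U P P' \<and> (\<forall>R\<in>S. adj ?U P R \<longrightarrow> adj ?U P' R)"
    using card_S clique P non_nbr
    by (intro el[unfolded elation_property_def, rule_format] conjI ballI impI) simp_all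
  then obtain P' where P': "P' \<in> points - ?U - S" "P' \<noteq> P" "\<not> adj ?U P P'"
      and nbrs: "\<And>R. R \<in> S \<Longrightarrow> adj ?U P R \<Longrightarrow> adj ?U P' R"
    by blast
  have "P' \<noteq> pt 1 m 0" for m
  proof
    assume "P' = pt 1 m 0"
    then have "adj ?U P P'"
      using P P' by (intro adj_line_infinity) (auto simp: P_def pt_subset_affine_lines)
    then show False using P' by simp
  qed
  then obtain x' e where P'_eq: "P' = pt x' e 1"
    using P' pt_cases[of P'] pt_in_affine_curve(3) by (metis DiffD1 DiffD2)
  have e0: "e \<noteq> 0"
    using P' by (auto simp: P'_eq S_def pt_subset_affine_lines)
  have X_S: "pt 1 0 0 \<in> S" by (simp add: S_def pt_in_points pt_in_affine_curve pt_subset_affine_lines)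
  have "adj ?U P (pt 1 0 0)"
    using P c by (intro adj_line_infinity) (auto simp: P_def pt_in_points pt_subset_affine_lines pt_eq_iff)
  then have "adj ?U P' (pt 1 0 0)" using nbrs X_S by blast
  moreover have "adj ?U P' (pt 1 0 0) \<longleftrightarrow> e - cj e = \<Psi> 0"
    unfolding P'_eq by (rule adj_graph) (auto simp: pt_in_points pt_eq_iff pt_subset_affine_lines)
  ultimately have e: "cj e = e" using aniso(2)[of 0] by simp
  have "z \<noteq> 0 \<and> - (x' * (e * c / z)) + cj (x' * (e * c / z)) = \<Psi> (e * c / z)"
    if z: "z - cj z = \<Psi> c + (c * x' - cj (c * x'))" for z
  proof -
    define k where "k = z - c * x'"
    have k: "k - cj k = \<Psi> c" using z by (simp add: k_def algebra_simps)
    have "k \<noteq> 0" using k aniso(2)[of c] c by auto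
    define R where "R = pt (- (k / c)) 0 1"
    have R: "R \<in> S" unfolding R_def using c \<open>k \<noteq> 0\<close> by (intro axis_in_S) simp
    then have R': "R \<in> points" by (simp add: S_def)
    have "adj ?U P R \<longleftrightarrow> k - cj k = \<Psi> c"
      using R' P c unfolding P_def R_def by (intro adj_graph) (auto simp: pt_eq_iff pt_subset_affine_lines)
    then have adj': "adj ?U P' R" using k nbrs R by blast
    then have ne: "P' \<noteq> R" by (simp add: adj_def)
    have z0: "z \<noteq> 0"
    proof
      assume "z = 0"
      then have "x' = - (k / c)" using c by (simp add: k_def)
      then have "\<not> adj ?U P' R"
        using P' R' ne trace(1)
        by (intro not_adj_line_vertical[where a = x']) (auto simp: P'_eq R_def pt_subset_affine_lines)
      then show False using adj' by simp
    qed
    define m where "m = e * c / z"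
    have "adj ?U P' R \<longleftrightarrow> (e - m * x') - cj (e - m * x') = \<Psi> m"
      using P' R' ne c z0 by (intro adj_graph)
        (auto simp: P'_eq R_def pt_subset_affine_lines m_def k_def field_simps)
    then have "- (x' * m) + cj (x' * m) = \<Psi> m" using adj' e by (simp add: algebra_simps)
    then show ?thesis using z0 by (simp only: m_def simp_thms)
  qed
  then show ?thesis using e0 e by blast
qed

end

section \<open>Orthogonal Buekenhout-Metz unitals\<close>

context quadratic_field
begin

definition quad :: "'k \<Rightarrow> 'k \<Rightarrow> 'k \<Rightarrow> 'k" where
  "quad \<alpha> \<gamma> x = \<alpha> * x ^ 2 - cj (\<alpha> * x ^ 2) + \<gamma> * nm x"

definition quad_grad :: "'k \<Rightarrow> 'k \<Rightarrow> 'k \<Rightarrow> 'k" where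
  "quad_grad \<alpha> \<gamma> x = 2 * \<alpha> * x + \<gamma> * cj x"

lemma cj_quad: "cj \<gamma> = - \<gamma> \<Longrightarrow> cj (quad \<alpha> \<gamma> x) = - quad \<alpha> \<gamma> x"
  by (simp add: quad_def nm_def algebra_simps)

lemma quad_add:
  "cj \<gamma> = - \<gamma> \<Longrightarrow>
    quad \<alpha> \<gamma> (x + y) = quad \<alpha> \<gamma> x + quad \<alpha> \<gamma> y + (quad_grad \<alpha> \<gamma> x * y - cj (quad_grad \<alpha> \<gamma> x * y))"
  by (simp add: quad_def quad_grad_def nm_def power2_eq_square algebra_simps)

lemma quad_scale: "cj t = t \<Longrightarrow> quad \<alpha> \<gamma> (t * x) = t ^ 2 * quad \<alpha> \<gamma> x"
  by (simp add: quad_def nm_def power2_eq_square algebra_simps)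

lemma quad_0 [simp]: "quad \<alpha> \<gamma> 0 = 0"
  by (simp add: quad_def nm_def)

text \<open>
  The tangent line at the point with first coordinate \<open>a\<close> has slope \<open>m = quad_grad a\<close>, and it is
  \<open>y = m x + k\<close> with \<open>k - cj k = - quad a\<close>. Expressed in \<open>m\<close>, this is a form of the same shape:
  the tangents form a Buekenhout-Metz unital in the dual plane.
\<close>

lemma quad_dual:
  assumes \<gamma>: "cj \<gamma> = - \<gamma>" and D: "D = \<gamma> ^ 2 + 4 * nm \<alpha>" "D \<noteq> 0"
  shows "\<exists>a. quad_grad \<alpha> \<gamma> a = m \<and> quad (- cj \<alpha> / D) (\<gamma> / D) m = - quad \<alpha> \<gamma> a"
proof -
  have cjD: "cj D = D" by (simp add: D nm_def \<gamma> mult.commute)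
  define a where "a = (2 * cj \<alpha> * m - \<gamma> * cj m) / D"
  have "D * quad_grad \<alpha> \<gamma> a = D * m"
    using D(2) by (simp add: quad_grad_def a_def cjD \<gamma> field_simps)
      (simp add: D(1) nm_def power2_eq_square algebra_simps)
  then have "quad_grad \<alpha> \<gamma> a = m" using D(2) by simp
  moreover have "D ^ 2 * quad \<alpha> \<gamma> a = D * (cj \<alpha> * m ^ 2 - \<alpha> * cj m ^ 2 - \<gamma> * m * cj m)"
    using D(2) by (simp add: quad_def nm_def a_def cjD \<gamma> power2_eq_square field_simps)
      (simp add: D(1) nm_def power2_eq_square algebra_simps)
  then have "D * quad \<alpha> \<gamma> a = cj \<alpha> * m ^ 2 - \<alpha> * cj m ^ 2 - \<gamma> * m * cj m"
    using D(2) by (simp add: power2_eq_square)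
  then have "quad \<alpha> \<gamma> a = (cj \<alpha> * m ^ 2 - \<alpha> * cj m ^ 2 - \<gamma> * m * cj m) / D"
    using D(2) by (simp add: field_simps)
  then have "quad (- cj \<alpha> / D) (\<gamma> / D) m = - quad \<alpha> \<gamma> a"
    by (simp add: quad_def nm_def cjD add_divide_distrib diff_divide_distrib mult.assoc)
  ultimately show ?thesis by blast
qed

text \<open>
  Substituting \<open>x = a + t\<close>, where \<open>a\<close> is the point whose tangent has slope \<open>m\<close>, removes the linear
  part. What remains is a level set of an anisotropic form, and only the level \<open>0\<close> has exactly
  one point.
\<close>

lemma tangent_quad_iff:
  assumes \<gamma>: "cj \<gamma> = - \<gamma>" and aniso: "\<And>x. quad \<alpha> \<gamma> x = 0 \<Longrightarrow> x = 0"
    and D: "D = \<gamma> ^ 2 + 4 * nm \<alpha>" "D \<noteq> 0"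
  shows "card {x. m * x + k - cj (m * x + k) = quad \<alpha> \<gamma> x} = 1 \<longleftrightarrow>
    k - cj k = quad (- cj \<alpha> / D) (\<gamma> / D) m"
proof -
  let ?Q = "quad \<alpha> \<gamma>" and ?g = "quad_grad \<alpha> \<gamma>"
  obtain a where ga: "?g a = m" and Qa: "quad (- cj \<alpha> / D) (\<gamma> / D) m = - ?Q a"
    using quad_dual[OF \<gamma> D] by blast
  have inv: "2 * cj \<alpha> * ?g x - \<gamma> * cj (?g x) = D * x" for x
    by (simp add: quad_grad_def D nm_def \<gamma> power2_eq_square algebra_simps)
  have ma: "m * a - cj (m * a) = 2 * ?Q a"
  proof -
    have "?g x * x - cj (?g x * x) = 2 * ?Q x" for x
      by (simp add: quad_def quad_grad_def nm_def \<gamma> power2_eq_square algebra_simps)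
    then show ?thesis using ga by metis
  qed
  define s where "s = k - cj k + ?Q a"
  have shift: "m * (a + t) + k - cj (m * (a + t) + k) = ?Q (a + t) \<longleftrightarrow> ?Q t = s" for t
  proof -
    have "m * (a + t) + k - cj (m * (a + t) + k) - ?Q (a + t) = s - ?Q t"
      using ma by (simp add: quad_add[OF \<gamma>] ga s_def cj_quad[OF \<gamma>] algebra_simps)
    then show ?thesis
      unfolding eq_iff_diff_eq_0[of "m * (a + t) + k - cj (m * (a + t) + k)"] by auto
  qed
  have sol: "{x. m * x + k - cj (m * x + k) = ?Q x} = {x. ?Q (x - a) = s}"
    using shift[of "x - a" for x] by (simp only: add_diff_cancel_left' add_diff_eq)
  have "bij_betw (\<lambda>t. a + t) {t. ?Q t = s} {x. m * x + k - cj (m * x + k) = ?Q x}"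
    unfolding sol by (intro bij_betw_byWitness[where f' = "\<lambda>x. x - a"]) auto
  then have card_eq: "card {x. m * x + k - cj (m * x + k) = ?Q x} = card {t. ?Q t = s}"
    by (rule bij_betw_same_card[symmetric])
  have "card {t. ?Q t = s} = 1 \<longleftrightarrow> s = 0"
  proof
    assume "s = 0"
    then have "{t. ?Q t = s} = {0}" using aniso by auto
    then show "card {t. ?Q t = s} = 1" by simp
  next
    assume "card {t. ?Q t = s} = 1"
    then obtain t where t: "{t. ?Q t = s} = {t}" by (auto simp: card_1_singleton_iff)
    then have Qt: "?Q t = s" by auto
    show "s = 0"
    proof (rule ccontr)
      assume "s \<noteq> 0"
      then have "t \<noteq> 0" using Qt by auto
      have "?g t \<noteq> 0"
      proof
        assume "?g t = 0"
        then have "D * t = 0" using inv[of t] by simp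
        then show False using D(2) \<open>t \<noteq> 0\<close> by simp
      qed
      obtain w where w: "cj w \<noteq> w" using not_in_F by blast
      \<comment> \<open>A direction in which the tangent form at \<open>t\<close> does not vanish meets the level set again.\<close>
      define u where "u = w / ?g t"
      define l where "l = ?g t * u - cj (?g t * u)"
      have l: "l \<noteq> 0" "cj l = - l" using w \<open>?g t \<noteq> 0\<close> by (auto simp: l_def u_def)
      have u: "u \<noteq> 0" using l by (auto simp: l_def)
      then have Qu: "?Q u \<noteq> 0" using aniso by blast
      define r where "r = - l / ?Q u"
      have r: "r \<noteq> 0" "cj r = r" using l Qu by (simp_all add: r_def cj_quad[OF \<gamma>])
      have "?Q (t + r * u) = s + r ^ 2 * ?Q u + r * l"
        by (simp add: quad_add[OF \<gamma>] quad_scale r Qt l_def algebra_simps)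
      also have "\<dots> = s" using Qu by (simp add: r_def power2_eq_square)
      finally have "t + r * u \<in> {t. ?Q t = s}" by simp
      then have "t + r * u = t" unfolding t by simp
      then show False using r u by simp
    qed
  qed
  also have "\<dots> \<longleftrightarrow> k - cj k = quad (- cj \<alpha> / D) (\<gamma> / D) m"
    unfolding s_def Qa by (rule eq_neg_iff_add_eq_0[symmetric])
  finally show ?thesis unfolding card_eq .
qed

text \<open>
  The numbers \<open>z\<close> with \<open>z - cj z = \<psi>\<close> satisfy \<open>cj z = z - \<psi>\<close>, so the equation becomes a cubic in \<open>z\<close>
  with \<open>q\<close> roots. For \<open>q > 3\<close> it vanishes, and its constant term \<open>- A e\<^sup>2 \<psi>\<^sup>2\<close> gives \<open>A = 0\<close>. For \<open>q = 3\<close>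
  the cubic is a multiple of \<open>z\<^sup>3 - z + \<psi>\<close>, whose roots are the same three numbers; comparing
  constant terms shows that \<open>A\<close> is in \<open>F\<close>. As \<open>G = 0\<close> in this case, the form vanishes at \<open>1\<close>.
\<close>

lemma quad_elation_equation:
  assumes A: "A \<noteq> 0" and G: "cj G = - G" and aniso: "\<And>x. quad A G x = 0 \<Longrightarrow> x = 0"
    and e: "e \<noteq> 0" "cj e = e" and q3: "q = 3 \<Longrightarrow> G = 0"
    and eq: "\<And>z. z - cj z = quad A G 1 + (x - cj x) \<Longrightarrow>
      z \<noteq> 0 \<and> - (x * (e / z)) + cj (x * (e / z)) = quad A G (e / z)"
  shows False
proof -
  define \<psi> where "\<psi> = quad A G 1 + (x - cj x)"
  define Z where "Z = {z. z - cj z = \<psi>}"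
  have c\<psi>: "cj \<psi> = - \<psi>" by (simp add: \<psi>_def cj_quad[OF G])
  have card_Z: "card Z = q" unfolding Z_def by (rule card_fiber[OF c\<psi>])
  have \<psi>0: "\<psi> \<noteq> 0" using eq[of 0] by (auto simp: \<psi>_def)
  define m where "m = - x * e"
  define A' where "A' = A * e ^ 2"
  define G' where "G' = G * e ^ 2"
  have A': "A' \<noteq> 0" using A e by (simp add: A'_def)
  define p where "p = [: - A' * \<psi> ^ 2, m * \<psi> ^ 2 + 2 * A' * \<psi> + G' * \<psi>,
      - 2 * m * \<psi> + cj m * \<psi> - A' + cj A' - G', m - cj m :]"
  have root: "poly p z = 0" if "z \<in> Z" for z
  proof -
    have z: "z - cj z = \<psi>" using that by (simp add: Z_def)
    have z0: "z \<noteq> 0" and "- (x * (e / z)) + cj (x * (e / z)) = quad A G (e / z)"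
      using eq[of z] z by (auto simp: \<psi>_def)
    then have "m / z - cj m / cj z = A' / z ^ 2 - cj A' / cj z ^ 2 + G' / (z * cj z)"
      using e by (simp add: m_def A'_def G'_def quad_def nm_def power_divide power2_eq_square)
    then have "(m / z - cj m / cj z) * (z ^ 2 * cj z ^ 2) =
        (A' / z ^ 2 - cj A' / cj z ^ 2 + G' / (z * cj z)) * (z ^ 2 * cj z ^ 2)"
      by simp
    moreover have "(m / z - cj m / cj z) * (z ^ 2 * cj z ^ 2) = m * z * cj z ^ 2 - cj m * z ^ 2 * cj z"
      using z0 by (simp add: left_diff_distrib power2_eq_square)
    moreover have "(A' / z ^ 2 - cj A' / cj z ^ 2 + G' / (z * cj z)) * (z ^ 2 * cj z ^ 2) =
        A' * cj z ^ 2 - cj A' * z ^ 2 + G' * z * cj z"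
      using z0 by (simp add: left_diff_distrib distrib_right power2_eq_square)
    ultimately have "m * z * cj z ^ 2 - cj m * z ^ 2 * cj z = A' * cj z ^ 2 - cj A' * z ^ 2 + G' * z * cj z"
      by simp
    moreover have "cj z = z - \<psi>" using z by (simp add: algebra_simps)
    ultimately show ?thesis
      by (simp add: p_def power2_eq_square algebra_simps)
  qed
  show False
  proof (cases "q = 3")
    case False
    then have "degree p < card Z" using q_gt_2 card_Z by (simp add: p_def degree_pCons_eq_if)
    then have "p = 0" using root card_roots_le by blast
    then have "coeff p 0 = 0" by simp
    then show False using A' \<psi>0 by (simp add: p_def)
  next
    case True
    define l where "l = m - cj m"
    define r where "r = p - smult l [: \<psi>, - 1, 0, 1 :]"
    have "poly r z = 0" if "z \<in> Z" for z
    proof -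
      have "cj z = z ^ q" by (rule cj_def)
      also have "\<dots> = z ^ 3" by (simp only: True)
      finally have "z ^ 3 = z - \<psi>" using that by (simp add: Z_def algebra_simps)
      moreover have "poly r z = poly p z - l * (z ^ 3 - z + \<psi>)"
        by (simp add: r_def power3_eq_cube algebra_simps)
      ultimately show ?thesis using root[OF that] by simp
    qed
    moreover have "degree r < card Z"
      using card_Z True by (simp add: r_def p_def l_def degree_pCons_eq_if)
    ultimately have "r = 0" using card_roots_le by blast
    then have "coeff r 0 = 0" by simp
    then have "- A' * \<psi> ^ 2 - l * \<psi> = 0" by (simp add: r_def p_def)
    then have "\<psi> * (A' * \<psi> + l) = 0" by algebra
    then have l: "l = - (A' * \<psi>)" using \<psi>0 by (simp add: eq_neg_iff_add_eq_0 add.commute)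
    have "cj l = - l" by (simp add: l_def)
    then have "cj A' * \<psi> = A' * \<psi>" by (simp add: l c\<psi>)
    then have "cj A' = A'" using \<psi>0 by simp
    then have "cj A = A" using e by (simp add: A'_def)
    then have "quad A G 1 = 0" using q3[OF True] by (simp add: quad_def)
    then show False using aniso by fastforce
  qed
qed

lemma char_eq_2:
  assumes "(2 :: 'k) = 0"
  shows "CHAR('k) = 2"
proof -
  have "CHAR('k) dvd 2" using assms of_nat_eq_0_iff_char_dvd[of 2, where 'a = 'k] by simp
  then show ?thesis using primes_dvd_imp_eq[OF prime_char two_is_prime_nat] by simp
qed

lemma two_eq_0_of_even: "even q \<Longrightarrow> (2 :: 'k) = 0"
proof -
  assume "even q"
  obtain n where "q = CHAR('k) ^ n" using q_char_power by blast
  with \<open>even q\<close> have "even CHAR('k)" by simp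
  then have "CHAR('k) = 2" using primes_dvd_imp_eq[OF two_is_prime_nat prime_char] by simp
  then show ?thesis using of_nat_CHAR[where 'a = 'k] by simp
qed

lemma abs_trace_artin_schreier:
  fixes u :: 'k
  assumes 2: "(2 :: 'k) = 0"
  shows "abs_trace m (u + u ^ 2) = u + u ^ (2 ^ m)"
proof (induction m)
  case 0
  have "u + u = 2 * u" by simp
  then show ?case by (simp add: abs_trace_def 2)
next
  case (Suc m)
  have "(u + u ^ 2) ^ (2 ^ m) = u ^ (2 ^ m) + u ^ (2 ^ Suc m)"
    using freshmans_dream'[OF prime_char, of "2 ^ m" m u "u ^ 2"] char_eq_2[OF 2]
    by (simp add: power_mult[symmetric])
  then have "abs_trace (Suc m) (u + u ^ 2) = u + u ^ (2 ^ m) + (u ^ (2 ^ m) + u ^ (2 ^ Suc m))"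
    using Suc by (simp add: abs_trace_def)
  also have "\<dots> = u + u ^ (2 ^ Suc m) + 2 * u ^ (2 ^ m)" by (simp add: algebra_simps)
  finally show ?case by (simp add: 2)
qed

text \<open>
  A non-trivial zero of the form gives \<open>u\<close> with \<open>u - cj u = - \<gamma>\<close> and \<open>u * cj u = nm \<alpha>\<close>. Then the
  discriminant is the square of \<open>u + cj u\<close>. In characteristic 2 the quotient \<open>w = u / \<gamma>\<close> solves
  \<open>w + w\<^sup>2 = nm \<alpha> / \<gamma>\<^sup>2\<close> and is not in \<open>F\<close>, so the right-hand side has trace \<open>w + cj w = 1\<close>.
\<close>

lemma BM_params_anisotropic:
  assumes "BM_params q \<alpha> \<beta>" and \<gamma>: "\<gamma> = \<beta> - cj \<beta>" and Q: "quad \<alpha> \<gamma> x = 0"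
  shows "x = 0"
proof (rule ccontr)
  assume x: "x \<noteq> 0"
  have c\<gamma>: "cj \<gamma> = - \<gamma>" by (simp add: \<gamma>)
  have nx: "nm x \<noteq> 0" "cj (nm x) = nm x" using x by (simp_all add: nm_def mult.commute)
  define u where "u = \<alpha> * x ^ 2 / nm x"
  have sum: "u - cj u = - \<gamma>"
  proof -
    have "nm x * (u - cj u + \<gamma>) = quad \<alpha> \<gamma> x"
      using nx by (simp add: u_def quad_def right_diff_distrib distrib_left)
    then show ?thesis using Q nx by (simp add: eq_neg_iff_add_eq_0)
  qed
  have prod: "u * cj u = nm \<alpha>"
    using x by (simp add: u_def nm_def power2_eq_square)
  show False
    using assms(1) unfolding BM_params_def
  proof (elim disjE conjE exE)
    assume ns: "\<not> (\<exists>t\<in>GFq q. (\<beta> - \<beta> ^ q) ^ 2 + 4 * \<alpha> ^ (q + 1) = t ^ 2)"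
    have "(\<beta> - \<beta> ^ q) ^ 2 + 4 * \<alpha> ^ (q + 1) = \<gamma> ^ 2 + 4 * nm \<alpha>"
      by (simp add: \<gamma> nm_def cj_def)
    also have "\<dots> = (u - cj u) ^ 2 + 4 * (u * cj u)" by (simp add: sum prod)
    also have "\<dots> = (u + cj u) ^ 2" by (simp add: power2_eq_square algebra_simps)
    finally have "(\<beta> - \<beta> ^ q) ^ 2 + 4 * \<alpha> ^ (q + 1) = (u + cj u) ^ 2" .
    moreover have "u + cj u \<in> GFq q" by (simp add: GFq_def flip: cj_def)
    ultimately show False using ns by blast
  next
    fix m assume m: "q = 2 ^ m" "even q" "\<beta> \<notin> GFq q"
      and tr: "abs_trace m (\<alpha> ^ (q + 1) / (\<beta> + \<beta> ^ q) ^ 2) = 0"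
    have 2: "(2 :: 'k) = 0" using m two_eq_0_of_even by blast
    have neg: "- y = y" for y :: 'k
    proof -
      have "y + y = 2 * y" by simp
      then show ?thesis by (simp add: 2 neg_eq_iff_add_eq_0)
    qed
    have \<gamma>': "\<gamma> = \<beta> + cj \<beta>" using neg[of "cj \<beta>"] by (simp add: \<gamma> diff_conv_add_uminus del: add_uminus_conv_diff)
    have "cj \<beta> \<noteq> \<beta>" using m(3) unfolding GFq_def cj_def by blast
    then have \<gamma>0: "\<gamma> \<noteq> 0" by (auto simp: \<gamma>)
    define w where "w = u / \<gamma>"
    have cw: "cj w = w + 1"
    proof -
      have "cj u = u + \<gamma>" using sum by (simp add: algebra_simps)
      then have "cj w = (u + \<gamma>) / - \<gamma>" by (simp add: w_def c\<gamma>)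
      also have "\<dots> = (u + \<gamma>) / \<gamma>" by (simp only: neg)
      finally show ?thesis using \<gamma>0 by (simp add: w_def add_divide_distrib)
    qed
    have "\<alpha> ^ (q + 1) / (\<beta> + \<beta> ^ q) ^ 2 = nm \<alpha> / \<gamma> ^ 2" by (simp add: \<gamma>' nm_def cj_def)
    also have "\<dots> = w * (cj u / \<gamma>)" by (simp add: prod[symmetric] w_def power2_eq_square)
    also have "cj u / \<gamma> = cj u / cj \<gamma>" by (simp only: c\<gamma> neg)
    also have "\<dots> = cj w" by (simp add: w_def)
    also have "w * cj w = w + w ^ 2" by (simp add: cw power2_eq_square algebra_simps)
    finally have "w + w ^ (2 ^ m) = 0" using tr abs_trace_artin_schreier[OF 2] by simp
    moreover have "cj w = w ^ (2 ^ m)"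
    proof -
      have "cj w = w ^ q" by (rule cj_def)
      then show ?thesis using m(1) by simp
    qed
    ultimately have "w + cj w = 0" by simp
    moreover have "w + cj w = 2 * w + 1" by (simp add: cw)
    ultimately show False by (simp add: 2)
  qed
qed

lemma BM_params_discriminant:
  assumes "BM_params q \<alpha> \<beta>" and \<gamma>: "\<gamma> = \<beta> - cj \<beta>"
  shows "\<gamma> ^ 2 + 4 * nm \<alpha> \<noteq> 0"
  using assms(1) unfolding BM_params_def
proof (elim disjE conjE exE)
  assume ns: "\<not> (\<exists>t\<in>GFq q. (\<beta> - \<beta> ^ q) ^ 2 + 4 * \<alpha> ^ (q + 1) = t ^ 2)"
  moreover have "(0 :: 'k) \<in> GFq q" using q_gt_2 by (simp add: GFq_def)
  moreover have "\<alpha> ^ (q + 1) = nm \<alpha>" by (simp add: nm_def cj_def)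
  ultimately show ?thesis unfolding \<gamma> cj_def by force
next
  assume "even q" and \<beta>: "\<beta> \<notin> GFq q"
  then have "(2 :: 'k) = 0" using two_eq_0_of_even by blast
  then have "(4 :: 'k) = 0" by (metis mult_2 mult_zero_left numeral_Bit0)
  moreover have "\<gamma> \<noteq> 0" using \<beta> by (auto simp: \<gamma> GFq_def cj_def)
  ultimately show ?thesis by simp
qed

text \<open>
  In the field with nine elements, non-zero \<open>\<gamma>\<close> and \<open>\<alpha>\<close> have \<open>\<gamma>\<^sup>2 = -1\<close> and \<open>nm \<alpha> = 1\<close> or \<open>nm \<alpha> = -1\<close>.
  The discriminant is then \<open>0\<close> or \<open>1\<close>, which are squares.
\<close>

lemma BM_params_3:
  assumes "BM_params q \<alpha> \<beta>" and \<gamma>: "\<gamma> = \<beta> - cj \<beta>" and q: "q = 3" and \<alpha>: "\<alpha> \<noteq> 0"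
  shows "\<gamma> = 0"
proof (rule ccontr)
  assume "\<gamma> \<noteq> 0"
  have "CHAR('k) = 3"
  proof -
    obtain n where "3 = CHAR('k) ^ n" using q_char_power q by auto
    then have "CHAR('k) dvd 3" by (cases n) (simp, metis dvd_triv_left power_Suc)
    moreover have "prime (3 :: nat)" by simp
    ultimately show ?thesis using prime_char primes_dvd_imp_eq by blast
  qed
  then have 3: "(3 :: 'k) = 0" using of_nat_CHAR[where 'a = 'k] by simp
  have "(4 :: 'k) = 3 + 1" by simp
  then have 4: "(4 :: 'k) = 1" by (simp only: 3 add_0_left)
  have cube: "cj x = x * x ^ 2" for x
  proof -
    have "cj x = x ^ q" by (rule cj_def)
    also have "\<dots> = x ^ 3" by (simp only: q)
    finally show ?thesis by (simp add: power3_eq_cube power2_eq_square)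
  qed
  have "\<gamma> * \<gamma> ^ 2 = cj \<gamma>" by (rule cube[symmetric])
  also have "\<dots> = \<gamma> * -1" by (simp add: \<gamma>)
  finally have g: "\<gamma> ^ 2 = -1" using \<open>\<gamma> \<noteq> 0\<close> by (simp only: mult_cancel_left simp_thms)
  have "nm \<alpha> * nm \<alpha> ^ 2 = cj (nm \<alpha>)" by (rule cube[symmetric])
  also have "\<dots> = nm \<alpha> * 1" by (simp add: nm_def mult.commute)
  finally have "nm \<alpha> ^ 2 = 1" using \<alpha> by (simp add: nm_def)
  then consider "nm \<alpha> = 1" | "nm \<alpha> = -1" by (metis power2_eq_1_iff)
  then have "\<exists>t\<in>{0, 1}. \<gamma> ^ 2 + 4 * nm \<alpha> = t ^ 2"
    by cases (use 3 in \<open>simp_all add: g 4\<close>)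
  then obtain t where t: "t \<in> {0, 1}" "\<gamma> ^ 2 + 4 * nm \<alpha> = t ^ 2" by blast
  have "t \<in> GFq q" using t(1) q_gt_2 by (auto simp: GFq_def)
  moreover have "(\<beta> - \<beta> ^ q) ^ 2 + 4 * \<alpha> ^ (q + 1) = t ^ 2"
    unfolding t(2)[symmetric] by (simp add: \<gamma> nm_def cj_def)
  ultimately have "\<exists>t\<in>GFq q. (\<beta> - \<beta> ^ q) ^ 2 + 4 * \<alpha> ^ (q + 1) = t ^ 2" by blast
  moreover have "odd q" by (simp add: q)
  ultimately show False using assms(1) unfolding BM_params_def by blast
qed

lemma BM_set_eq: "BM_set q \<alpha> \<beta> = affine_curve (quad \<alpha> (\<beta> - cj \<beta>))"
proof -
  have "(\<exists>z\<in>GFq q. y = \<alpha> * x ^ 2 + \<beta> * x ^ (q + 1) + z) \<longleftrightarrow> y - cj y = quad \<alpha> (\<beta> - cj \<beta>) x" for x y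
  proof -
    define b where "b = \<alpha> * x ^ 2 + \<beta> * x ^ (q + 1)"
    have "b - cj b = quad \<alpha> (\<beta> - cj \<beta>) x"
      by (simp add: b_def quad_def nm_def cj_def[symmetric] algebra_simps)
    moreover have "(\<exists>z\<in>GFq q. y = b + z) \<longleftrightarrow> cj (y - b) = y - b"
      by (auto simp: GFq_def cj_def intro!: bexI[of _ "y - b"])
    moreover have "cj (y - b) = y - b \<longleftrightarrow> y - cj y = b - cj b" by (auto simp: algebra_simps)
    ultimately show ?thesis by (simp add: b_def)
  qed
  then have "affine_curve (quad \<alpha> (\<beta> - cj \<beta>)) =
      {pt x y 1 | x y. \<exists>z\<in>GFq q. y = \<alpha> * x ^ 2 + \<beta> * x ^ (q + 1) + z} \<union> {pt 0 1 0}"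
    by (simp only: affine_curve_def)
  also have "\<dots> = BM_set q \<alpha> \<beta>" unfolding BM_set_def by blast
  finally show ?thesis by simp
qed

lemma not_elation_property_BM_set:
  fixes \<alpha> \<beta> :: 'k
  assumes params: "BM_params q \<alpha> \<beta>" and \<alpha>: "\<alpha> \<noteq> 0"
  shows "\<not> elation_property (q + 3) (points - BM_set q \<alpha> \<beta>) (adj (BM_set q \<alpha> \<beta>))"
proof
  assume el: "elation_property (q + 3) (points - BM_set q \<alpha> \<beta>) (adj (BM_set q \<alpha> \<beta>))"
  define \<gamma> where "\<gamma> = \<beta> - cj \<beta>"
  define D where "D = \<gamma> ^ 2 + 4 * nm \<alpha>"
  define A where "A = - cj \<alpha> / D"
  define G where "G = \<gamma> / D"
  have c\<gamma>: "cj \<gamma> = - \<gamma>" by (simp add: \<gamma>_def)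
  have D: "D \<noteq> 0" unfolding D_def by (rule BM_params_discriminant[OF params \<gamma>_def])
  have "cj D = D" by (simp add: D_def nm_def c\<gamma> mult.commute)
  then have cG: "cj G = - G" by (simp add: G_def c\<gamma>)
  have aniso: "quad \<alpha> \<gamma> x = 0 \<longleftrightarrow> x = 0" for x
    using BM_params_anisotropic[OF params \<gamma>_def] by auto
  have tangents: "card {x. m * x + k - cj (m * x + k) = quad \<alpha> \<gamma> x} = 1 \<longleftrightarrow> k - cj k = quad A G m" for m k
    unfolding A_def G_def using tangent_quad_iff[OF c\<gamma> _ D_def D] aniso by blast
  have aniso': "quad A G m = 0 \<longleftrightarrow> m = 0" for m
  proof
    assume "quad A G m = 0"
    then obtain a where "quad_grad \<alpha> \<gamma> a = m" "quad \<alpha> \<gamma> a = 0"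
      using quad_dual[OF c\<gamma> D_def D, of m] by (auto simp: A_def G_def)
    then show "m = 0" using aniso by (auto simp: quad_grad_def)
  qed simp
  have "\<exists>e x'. e \<noteq> 0 \<and> cj e = e \<and>
    (\<forall>z. z - cj z = quad A G 1 + (1 * x' - cj (1 * x')) \<longrightarrow>
       z \<noteq> 0 \<and> - (x' * (e * 1 / z)) + cj (x' * (e * 1 / z)) = quad A G (e * 1 / z))"
    by (rule elation_property_affine_curve[OF cj_quad[OF c\<gamma>] cj_quad[OF cG] aniso aniso' tangents])
      (use el in \<open>simp_all add: BM_set_eq \<gamma>_def\<close>)
  then obtain e x' where "e \<noteq> 0" "cj e = e" and
    "\<And>z. z - cj z = quad A G 1 + (x' - cj x') \<Longrightarrow>
       z \<noteq> 0 \<and> - (x' * (e / z)) + cj (x' * (e / z)) = quad A G (e / z)"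
    by (auto simp del: cj_mult cj_divide)
  moreover have "A \<noteq> 0" using \<alpha> D by (simp add: A_def)
  moreover have "G = 0" if "q = 3" using BM_params_3[OF params \<gamma>_def that \<alpha>] by (simp add: G_def)
  ultimately show False using quad_elation_equation[of A G e x'] cG aniso' by blast
qed

text \<open>
  With \<open>\<alpha> = 0\<close> the equation of the unital is \<open>y - cj y = \<gamma> x cj x\<close>. It is skew-Hermitian, and
  multiplication by \<open>\<gamma>\<close> makes it Hermitian.
\<close>

lemma hermitian_curve_BM_set:
  fixes \<beta> :: 'k
  assumes "BM_params q 0 \<beta>"
  shows "hermitian_curve q (BM_set q 0 \<beta>)"
proof -
  define \<gamma> where "\<gamma> = \<beta> - cj \<beta>"
  have c\<gamma>: "cj \<gamma> = - \<gamma>" by (simp add: \<gamma>_def)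
  have "\<gamma> \<noteq> 0" using BM_params_discriminant[OF assms \<gamma>_def] by (auto simp: nm_def)
  define h where "h = (\<lambda>(v :: 'k ^ 3) (w :: 'k ^ 3).
    \<gamma> * (v $ 2 * cj (w $ 3) - v $ 3 * cj (w $ 2)) - \<gamma> ^ 2 * (v $ 1 * cj (w $ 1)))"
  interpret hermitian_plane q field_type h
  proof unfold_locales
    fix u v w :: "'k ^ 3" and a :: 'k
    show "h (u + v) w = h u w + h v w" by (simp add: h_def algebra_simps)
    show "h (a *s u) w = a * h u w" by (simp add: h_def algebra_simps)
    show "h w u = cj (h u w)" by (simp add: h_def c\<gamma> algebra_simps)
    assume 0: "\<And>w. h v w = 0"
    have "v $ 1 = 0" "v $ 2 = 0" "v $ 3 = 0"
      using 0[of "vector [1, 0, 0]"] 0[of "vector [0, 0, 1]"] 0[of "vector [0, 1, 0]"] \<open>\<gamma> \<noteq> 0\<close>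
      by (simp_all add: h_def vector_3)
    then show "v = 0" by (simp add: vec_eq_iff forall_3)
  qed
  have on_curve: "pt x y z \<in> curve \<longleftrightarrow> \<gamma> * (y * cj z - z * cj y) - \<gamma> ^ 2 * nm x = 0"
    if "x \<noteq> 0 \<or> y \<noteq> 0 \<or> z \<noteq> 0" for x y z
    using that unfolding pt_def
    by (subst span_in_curve) (auto simp: vector_3_eq_0_iff h_def vector_3 nm_def)
  have "P \<in> curve \<longleftrightarrow> P \<in> BM_set q 0 \<beta>" if "P \<in> points" for P
    using that
  proof (rule pt_cases)
    fix x y assume P: "P = pt x y 1"
    have "P \<in> curve \<longleftrightarrow> \<gamma> * (y - cj y - \<gamma> * nm x) = 0"
      unfolding P by (subst on_curve) (simp_all add: power2_eq_square algebra_simps)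
    then show ?thesis
      using \<open>\<gamma> \<noteq> 0\<close> by (simp add: P BM_set_eq pt_in_affine_curve quad_def \<gamma>_def)
  next
    fix m assume "P = pt 1 m 0"
    then show ?thesis
      using \<open>\<gamma> \<noteq> 0\<close> by (simp add: on_curve BM_set_eq pt_in_affine_curve nm_def)
  next
    assume "P = pt 0 1 0"
    then show ?thesis by (simp add: on_curve BM_set_eq pt_in_affine_curve nm_def)
  qed
  moreover have "curve \<subseteq> points" "BM_set q 0 \<beta> \<subseteq> points"
    by (auto simp: curve_def BM_set_eq intro: affine_curve_subset_points[THEN subsetD])
  ultimately have "curve = BM_set q 0 \<beta>" by blast
  then show ?thesis using hermitian_curve_curve by simp
qed

end

section \<open>Buekenhout-Tits unitals\<close>

locale tits_field = quadratic_field q field_type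
  for q and field_type :: "'k::{field,finite} itself" +
  fixes m :: nat and \<beta> :: 'k
  assumes q_eq: "q = 2 ^ m" and m_gt_1: "m > 1" and odd_m: "odd m" and \<beta>: "cj \<beta> \<noteq> \<beta>"
begin

definition \<delta> :: nat where
  "\<delta> = 2 ^ ((m + 1) div 2)"

text \<open>
  Raising to the power \<open>\<delta>\<close> is an automorphism of \<open>F\<close> whose square is the Frobenius map \<open>x \<mapsto> x\<^sup>2\<close>; raising
  to the power \<open>\<epsilon>\<close> inverts it.
\<close>

definition \<epsilon> :: nat where
  "\<epsilon> = 2 ^ (m div 2)"

lemma \<delta>_\<epsilon>: "\<delta> = 2 * \<epsilon>" "\<epsilon> * \<delta> = q"
proof -
  obtain n where n: "m = 2 * n + 1" using odd_m by (rule oddE)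
  show "\<delta> = 2 * \<epsilon>" unfolding \<delta>_def \<epsilon>_def by (simp add: n)
  have "m div 2 + (m + 1) div 2 = m" by (simp add: n)
  then show "\<epsilon> * \<delta> = q" unfolding \<delta>_def \<epsilon>_def by (simp add: q_eq flip: power_add)
qed

lemma \<epsilon>_cases: "q = 8 \<and> \<delta> = 4 \<or> \<epsilon> \<ge> 4"
proof -
  obtain n where n: "m = 2 * n + 1" using odd_m by (rule oddE)
  have "n \<ge> 1" using m_gt_1 n by simp
  show ?thesis
  proof (cases "n = 1")
    case True
    then have "m = 3" by (simp add: n)
    then have "q = 2 ^ 3" "(m + 1) div 2 = 2" by (simp_all add: q_eq)
    then show ?thesis unfolding \<delta>_def by simp
  next
    case False
    then have "2 ^ 2 \<le> (2 :: nat) ^ n" using \<open>n \<ge> 1\<close> by (intro power_increasing) auto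
    moreover have "m div 2 = n" by (simp add: n)
    ultimately show ?thesis unfolding \<epsilon>_def by simp
  qed
qed

lemma two_eq_0: "(2 :: 'k) = 0"
  using m_gt_1 by (intro two_eq_0_of_even) (simp add: q_eq)

lemma minus_eq: "- x = x" for x :: 'k
proof -
  have "x + x = 2 * x" by simp
  then show ?thesis by (simp add: two_eq_0 neg_eq_iff_add_eq_0)
qed

lemma power_2_power_add: "(x + y) ^ 2 ^ n = x ^ 2 ^ n + y ^ 2 ^ n" for x y :: 'k
  using freshmans_dream'[OF prime_char, of "2 ^ n" n x y] char_eq_2[OF two_eq_0] by simp

lemma power_\<delta>_add: "(x + y) ^ \<delta> = x ^ \<delta> + y ^ \<delta>" for x y :: 'k
  unfolding \<delta>_def by (rule power_2_power_add)

lemma power_\<delta>_\<delta>: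
  assumes "cj x = x"
  shows "(x ^ \<delta>) ^ \<delta> = x ^ 2"
proof -
  have "\<delta> * \<delta> = q * 2" using \<delta>_\<epsilon> by (metis mult.assoc mult.commute)
  then have "(x ^ \<delta>) ^ \<delta> = (x ^ q) ^ 2" by (simp flip: power_mult)
  also have "x ^ q = x" using assms by (simp only: cj_def)
  finally show ?thesis .
qed

lemma power_\<epsilon>_\<delta>:
  assumes "cj x = x"
  shows "(x ^ \<epsilon>) ^ \<delta> = x"
proof -
  have "(x ^ \<epsilon>) ^ \<delta> = x ^ q" by (simp add: \<delta>_\<epsilon>(2) flip: power_mult)
  then show ?thesis using assms by (simp only: cj_def)
qed

lemma \<delta>_pos: "\<delta> > 0" and \<epsilon>_pos: "\<epsilon> > 0"
  by (simp_all add: \<delta>_def \<epsilon>_def)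

definition tits :: "'k \<Rightarrow> 'k \<Rightarrow> 'k" where
  "tits x y = x ^ (\<delta> + 2) + x * y + y ^ \<delta>"

lemma cj_tits: "cj x = x \<Longrightarrow> cj y = y \<Longrightarrow> cj (tits x y) = tits x y"
  by (simp add: tits_def)

text \<open>
  The shear \<open>(s, t) \<mapsto> (s, t + a ^ \<delta> s)\<close> belongs to the group of the Tits ovoid. Up to a linear term
  and this shear, the function \<open>tits\<close> is invariant under translation.
\<close>

lemma tits_add:
  assumes "cj a = a"
  shows "tits (a + s) (b + t) = tits a b + tits s (t + a ^ \<delta> * s) + (a * t + b * s)"
proof -
  show ?thesis
    by (simp add: tits_def power_\<delta>_add power_add power_mult_distrib power_\<delta>_\<delta>[OF assms]
        power2_eq_square two_eq_0 algebra_simps)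
qed

text \<open>
  Dividing by \<open>x ^ (\<delta> + 2)\<close> leads to \<open>u ^ \<delta> = u + 1\<close>. Applying the automorphism again gives
  \<open>u\<^sup>2 = u\<close>, and neither \<open>0\<close> nor \<open>1\<close> is a solution.
\<close>

lemma tits_eq_0_iff:
  assumes x: "cj x = x" and y: "cj y = y"
  shows "tits x y = 0 \<longleftrightarrow> x = 0 \<and> y = 0"
proof
  assume 0: "tits x y = 0"
  show "x = 0 \<and> y = 0"
  proof (cases "x = 0")
    case True
    then show ?thesis using 0 \<delta>_pos by (simp add: tits_def)
  next
    case False
    define u where "u = y / x ^ (\<delta> + 1)"
    have cu: "cj u = u" by (simp add: u_def x y)
    have y_eq: "y = u * (x ^ \<delta> * x)" using False by (simp add: u_def mult.commute)
    have "y ^ \<delta> = u ^ \<delta> * (x ^ 2 * x ^ \<delta>)"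
      by (simp add: y_eq power_mult_distrib power_\<delta>_\<delta>[OF x])
    then have "tits x y = x ^ (\<delta> + 2) * (1 + u + u ^ \<delta>)"
      by (simp add: tits_def y_eq power_add power2_eq_square algebra_simps)
    then have "1 + u + u ^ \<delta> = 0" using 0 False by simp
    then have ud: "u ^ \<delta> = u + 1" by (metis add.commute eq_neg_iff_add_eq_0 minus_eq)
    have "u ^ 2 = (u ^ \<delta>) ^ \<delta>" by (simp add: power_\<delta>_\<delta>[OF cu])
    also have "\<dots> = u + 1 + 1" unfolding ud by (simp add: power_\<delta>_add ud)
    also have "\<dots> = u" using two_eq_0 by simp
    finally have "u = 0 \<or> u = 1" by (simp add: power2_eq_square)
    then show ?thesis
    proof
      assume "u = 0"
      then show ?thesis using ud \<delta>_pos by (simp add: zero_power)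
    next
      assume "u = 1"
      then show ?thesis using ud two_eq_0 by simp
    qed
  qed
next
  show "x = 0 \<and> y = 0 \<Longrightarrow> tits x y = 0" using \<delta>_pos by (simp add: tits_def)
qed

text \<open>
  Coordinates with respect to the basis \<open>1, \<beta>\<close> over \<open>F\<close>.
\<close>

definition co1 :: "'k \<Rightarrow> 'k" where
  "co1 x = (x - cj x) / (\<beta> - cj \<beta>)"

definition co0 :: "'k \<Rightarrow> 'k" where
  "co0 x = x - co1 x * \<beta>"

lemma cj_co [simp]: "cj (co1 x) = co1 x" "cj (co0 x) = co0 x"
proof -
  show 1: "cj (co1 x) = co1 x"
    by (simp add: co1_def) (metis minus_diff_eq minus_divide_divide)
  have "co1 x * (\<beta> - cj \<beta>) = x - cj x" using \<beta> by (simp add: co1_def)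
  then show "cj (co0 x) = co0 x" by (simp add: co0_def 1 algebra_simps)
qed

lemma co_eq: "co0 x + co1 x * \<beta> = x"
  by (simp add: co0_def)

lemma co_unique:
  assumes "cj x0 = x0" "cj x1 = x1"
  shows "co1 (x0 + x1 * \<beta>) = x1" "co0 (x0 + x1 * \<beta>) = x0"
proof -
  show 1: "co1 (x0 + x1 * \<beta>) = x1"
    using assms \<beta> by (simp add: co1_def right_diff_distrib[symmetric])
  show "co0 (x0 + x1 * \<beta>) = x0" unfolding co0_def 1 by simp
qed

lemma co_add: "co1 (x + y) = co1 x + co1 y" "co0 (x + y) = co0 x + co0 y"
proof -
  show 1: "co1 (x + y) = co1 x + co1 y" by (simp add: co1_def add_divide_distrib[symmetric])
  show "co0 (x + y) = co0 x + co0 y" unfolding co0_def 1 by (simp add: algebra_simps)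
qed

definition tits_form :: "'k \<Rightarrow> 'k" where
  "tits_form x = (\<beta> - cj \<beta>) * tits (co0 x) (co1 x)"

lemma cj_tits_form: "cj (tits_form x) = - tits_form x"
  by (simp add: tits_form_def cj_tits algebra_simps)

lemma tits_form_eq_0_iff: "tits_form x = 0 \<longleftrightarrow> x = 0"
proof
  assume "tits_form x = 0"
  then have "co0 x = 0 \<and> co1 x = 0" using \<beta> by (simp add: tits_form_def tits_eq_0_iff)
  then show "x = 0" using co_eq[of x] by simp
next
  assume "x = 0"
  then show "tits_form x = 0" using \<delta>_pos by (simp add: tits_form_def tits_def co0_def co1_def)
qed

lemma card_tits_fiber:
  assumes s: "cj s = s"
  shows "card {t. tits (co0 t) (co1 t) = s} = 1 \<longleftrightarrow> s = 0"
proof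
  assume "s = 0"
  then have "{t. tits (co0 t) (co1 t) = s} = {0}"
    using tits_form_eq_0_iff \<beta> by (auto simp: tits_form_def)
  then show "card {t. tits (co0 t) (co1 t) = s} = 1" by simp
next
  assume "card {t. tits (co0 t) (co1 t) = s} = 1"
  then obtain t where t: "{t. tits (co0 t) (co1 t) = s} = {t}" by (auto simp: card_1_singleton_iff)
  show "s = 0"
  proof (rule ccontr)
    assume s0: "s \<noteq> 0"
    \<comment> \<open>The level set meets both coordinate axes, at points with explicit coordinates.\<close>
    define y where "y = s ^ \<epsilon>"
    define x where "x = s / s ^ \<epsilon>"
    have cxy: "cj x = x" "cj y = y" by (simp_all add: x_def y_def s)
    have yd: "y ^ \<delta> = s" by (simp add: y_def power_\<epsilon>_\<delta>[OF s])
    have xy: "x * y = s" using s0 by (simp add: x_def y_def)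
    have y2: "y ^ 2 = s ^ \<delta>" by (simp add: y_def \<delta>_\<epsilon>(1) mult.commute flip: power_mult)
    have yd2: "y ^ (\<delta> + 2) = s * s ^ \<delta>" by (simp only: power_add yd y2)
    have "x ^ (\<delta> + 2) * y ^ (\<delta> + 2) = s ^ (\<delta> + 2)"
      unfolding xy[symmetric] by (rule power_mult_distrib[symmetric])
    then have "x ^ (\<delta> + 2) = s" using s0 unfolding yd2 by (simp add: power_add power2_eq_square)
    then have "tits x 0 = s" "tits 0 y = s" using \<delta>_pos yd by (simp_all add: tits_def)
    then have "x + 0 * \<beta> \<in> {t. tits (co0 t) (co1 t) = s}" "0 + y * \<beta> \<in> {t. tits (co0 t) (co1 t) = s}"
      using cxy by (simp_all only: mem_Collect_eq co_unique cj_0)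
    then have "x + 0 * \<beta> = 0 + y * \<beta>" unfolding t by simp
    then have "co1 (x + 0 * \<beta>) = co1 (0 + y * \<beta>)" by simp
    then have "y = 0" using cxy by (simp only: co_unique cj_0)
    then show False using s0 by (simp add: y_def)
  qed
qed

text \<open>
  The tangent with contact point over \<open>a\<close> has slope \<open>cj a\<close>: recentering at \<open>a = cj n\<close> cancels the
  linear terms, and after the shear a level set of \<open>tits\<close> remains.
\<close>

lemma tangent_tits_iff:
  "card {x. n * x + k - cj (n * x + k) = tits_form x} = 1 \<longleftrightarrow> k - cj k = tits_form (cj n)"
proof -
  define \<kappa> where "\<kappa> = \<beta> - cj \<beta>"
  have \<kappa>: "\<kappa> \<noteq> 0" "cj \<kappa> = - \<kappa>" using \<beta> by (auto simp: \<kappa>_def)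
  define a where "a = cj n"
  define s where "s = (k - cj k - tits_form a) / \<kappa>"
  have s: "cj s = s"
  proof -
    have "cj s = - (k - cj k - tits_form a) / - \<kappa>" by (simp add: s_def \<kappa> cj_tits_form)
    then show ?thesis by (simp only: s_def minus_divide_divide)
  qed
  define shear where "shear t = t + co0 a ^ \<delta> * co0 t * \<beta>" for t
  have shear_co: "co0 (shear t) = co0 t" "co1 (shear t) = co1 t + co0 a ^ \<delta> * co0 t" for t
  proof -
    have "shear t = co0 t + (co1 t + co0 a ^ \<delta> * co0 t) * \<beta>"
      using co_eq[of t] by (simp add: shear_def algebra_simps)
    then show "co0 (shear t) = co0 t" "co1 (shear t) = co1 t + co0 a ^ \<delta> * co0 t"
      by (simp_all only:) (subst co_unique; simp)+
  qed
  have shear_inv: "shear (shear t) = t" for t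
  proof -
    have "shear (shear t) = t + 2 * (co0 a ^ \<delta> * co0 t * \<beta>)"
      unfolding shear_def[of "shear t"] shear_co by (simp add: shear_def)
    then show ?thesis by (simp add: two_eq_0)
  qed
  have shift: "n * (a + t) + k - cj (n * (a + t) + k) = tits_form (a + t) \<longleftrightarrow>
      tits (co0 (shear t)) (co1 (shear t)) = s" for t
  proof -
    have polar: "cj a * t - a * cj t = \<kappa> * (co0 a * co1 t + co1 a * co0 t)"
    proof -
      have "cj a * t - a * cj t = \<kappa> * (co0 a * co1 t - co1 a * co0 t)"
        by (subst (1 2) co_eq[of a, symmetric], subst (1 2) co_eq[of t, symmetric])
          (simp add: \<kappa>_def algebra_simps)
      then show ?thesis using minus_eq[of "co1 a * co0 t"] by (metis diff_conv_add_uminus)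
    qed
    have "n * (a + t) + k - cj (n * (a + t) + k) = (cj a * t - a * cj t) + (k - cj k)"
      by (simp add: a_def algebra_simps)
    also have "\<dots> = \<kappa> * (co0 a * co1 t + co1 a * co0 t) + (k - cj k)" by (simp only: polar)
    finally have 1: "n * (a + t) + k - cj (n * (a + t) + k) =
      \<kappa> * (co0 a * co1 t + co1 a * co0 t) + (k - cj k)" .
    have 2: "tits_form (a + t) = tits_form a + \<kappa> * tits (co0 (shear t)) (co1 (shear t)) +
        \<kappa> * (co0 a * co1 t + co1 a * co0 t)"
      by (simp add: tits_form_def co_add tits_add shear_co \<kappa>_def[symmetric] algebra_simps)
    show ?thesis
      unfolding 1 2 s_def using \<kappa>(1) by (auto simp: field_simps)
  qed
  have "bij_betw (\<lambda>t. a + shear t) {t. tits (co0 t) (co1 t) = s}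
      {x. n * x + k - cj (n * x + k) = tits_form x}"
    (is "bij_betw _ ?A ?B")
  proof (rule bij_betw_byWitness[where f' = "\<lambda>x. shear (x - a)"])
    show "\<forall>t\<in>?A. shear (a + shear t - a) = t" by (simp add: shear_inv)
    show "\<forall>x\<in>?B. a + shear (shear (x - a)) = x" by (simp add: shear_inv)
    show "(\<lambda>t. a + shear t) ` ?A \<subseteq> ?B"
    proof
      fix x assume "x \<in> (\<lambda>t. a + shear t) ` ?A"
      then obtain t where "t \<in> ?A" "x = a + shear t" by blast
      then show "x \<in> ?B" unfolding mem_Collect_eq using shift[of "shear t"] by (simp only: shear_inv)
    qed
    show "(\<lambda>x. shear (x - a)) ` ?B \<subseteq> ?A"
    proof
      fix t assume "t \<in> (\<lambda>x. shear (x - a)) ` ?B"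
      then obtain x where x: "x \<in> ?B" "t = shear (x - a)" by blast
      have ax: "a + (x - a) = x" by simp
      have "tits (co0 t) (co1 t) = s"
        using x(1) shift[of "x - a"] unfolding x(2) ax mem_Collect_eq by blast
      then show "t \<in> ?A" by (simp only: mem_Collect_eq)
    qed
  qed
  then have "card ?B = card ?A" by (rule bij_betw_same_card[symmetric])
  also have "card ?A = 1 \<longleftrightarrow> s = 0" by (rule card_tits_fiber[OF s])
  also have "\<dots> \<longleftrightarrow> k - cj k = tits_form (cj n)" using \<kappa> by (simp add: s_def a_def)
  finally show ?thesis .
qed

lemma BT_set_eq: "BT_set q \<delta> \<beta> = affine_curve tits_form"
proof -
  have "(\<exists>x0 x1 z. x = x0 + x1 * \<beta> \<and> y = (x0 ^ (\<delta> + 2) + x0 * x1 + x1 ^ \<delta>) * \<beta> + z \<and>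
      x0 \<in> GFq q \<and> x1 \<in> GFq q \<and> z \<in> GFq q) \<longleftrightarrow> y - cj y = tits_form x" (is "?L \<longleftrightarrow> ?R") for x y
  proof
    assume ?L
    then obtain x0 x1 z where x: "x = x0 + x1 * \<beta>" "cj x0 = x0" "cj x1 = x1"
      and y: "y = tits x0 x1 * \<beta> + z" "cj z = z"
      by (auto simp: GFq_def cj_def tits_def)
    have "tits_form x = (\<beta> - cj \<beta>) * tits x0 x1"
      by (simp only: tits_form_def x(1) co_unique[OF x(2,3)])
    then show ?R using x y by (simp add: cj_tits algebra_simps)
  next
    assume R: ?R
    define z where "z = y - tits (co0 x) (co1 x) * \<beta>"
    have "cj z = z" using R by (simp add: z_def tits_form_def cj_tits algebra_simps)
    moreover have "y = tits (co0 x) (co1 x) * \<beta> + z" by (simp add: z_def)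
    moreover have "cj (co0 x) = co0 x" "cj (co1 x) = co1 x" by simp_all
    ultimately show ?L
      unfolding GFq_def cj_def mem_Collect_eq tits_def using co_eq[of x] by metis
  qed
  then have "affine_curve tits_form = {pt x y 1 | x y. \<exists>x0 x1 z. x = x0 + x1 * \<beta> \<and>
      y = (x0 ^ (\<delta> + 2) + x0 * x1 + x1 ^ \<delta>) * \<beta> + z \<and>
      x0 \<in> GFq q \<and> x1 \<in> GFq q \<and> z \<in> GFq q} \<union> {pt 0 1 0}"
    by (simp only: affine_curve_def)
  also have "\<dots> = BT_set q \<delta> \<beta>" unfolding BT_set_def by blast
  finally show ?thesis by simp
qed

text \<open>
  With \<open>u = t ^ \<delta>\<close> both sides are polynomials in \<open>t\<close> and \<open>u\<close>, of degree at most 4 and 2. The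
  left-hand side lacks \<open>t\<^sup>3 u\<close> and \<open>t\<^sup>2\<close>, which kills \<open>l\<^sub>1\<close> and then \<open>l\<^sub>0\<close>. For \<open>q = 8\<close> the degree in
  \<open>t\<close> is too large, but \<open>u\<^sup>2 = t\<close> there, so reduction leaves degree 7.
\<close>

lemma tits_polynomial_identity:
  assumes k: "k \<noteq> 0" and T: "T \<noteq> 0" and M: "M \<noteq> 0"
    and eq: "\<And>t. cj t = t \<Longrightarrow>
      k ^ (\<delta> + 2) + t * k ^ 2 * (1 + T * t + M * t ^ 2) ^ \<delta> + t ^ \<delta> * k ^ \<delta> * (1 + T * t + M * t ^ 2) ^ 2 =
      k * (l0 + l1 * t) * (1 + T * t + M * t ^ 2) ^ (\<delta> + 1)"
  shows False
proof -
  define S where "S = T ^ \<delta>"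
  define N where "N = M ^ \<delta>"
  have S: "S \<noteq> 0" and N: "N \<noteq> 0" using T M by (simp_all add: S_def N_def)
  define b0 where "b0 = k * l0"
  define b1 where "b1 = k * (l0 * T + l1)"
  define b2 where "b2 = k * (l0 * M + l1 * T)"
  define b3 where "b3 = k * l1 * M"
  define p0 where "p0 = [: k ^ (\<delta> + 2) - b0, k ^ 2 - b1, - b2, - b3 :]"
  define p1 where "p1 = [: k ^ \<delta> - S * b0, S * (k ^ 2 - b1), k ^ \<delta> * T ^ 2 - S * b2, - S * b3, k ^ \<delta> * M ^ 2 :]"
  define p2 where "p2 = [: - N * b0, N * (k ^ 2 - b1), - N * b2, - N * b3 :]"
  have zero: "poly p0 t + t ^ \<delta> * poly p1 t + (t ^ \<delta>) ^ 2 * poly p2 t = 0" if "cj t = t" for t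
  proof -
    define u where "u = t ^ \<delta>"
    define n where "n = 1 + T * t + M * t ^ 2"
    have nd: "n ^ \<delta> = 1 + S * u + N * u ^ 2"
      by (simp add: n_def u_def S_def N_def power_\<delta>_add power_mult_distrib mult.commute flip: power_mult)
    have n2: "n ^ 2 = 1 + T ^ 2 * t ^ 2 + M ^ 2 * t ^ 4"
    proof -
      have "n ^ 2 = 1 + T ^ 2 * t ^ 2 + M ^ 2 * t ^ 4 + 2 * (T * t + M * t ^ 2 + T * M * t ^ 3)"
        by (simp add: n_def power2_eq_square power3_eq_cube power4_eq_xxxx algebra_simps)
      then show ?thesis by (simp add: two_eq_0)
    qed
    have "k ^ (\<delta> + 2) + t * k ^ 2 * n ^ \<delta> + u * k ^ \<delta> * n ^ 2 = k * (l0 + l1 * t) * (n ^ \<delta> * n)"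
      using eq[OF that] by (simp add: u_def n_def power_add)
    then have "k ^ (\<delta> + 2) + t * k ^ 2 * (1 + S * u + N * u ^ 2) + u * k ^ \<delta> * (1 + T ^ 2 * t ^ 2 + M ^ 2 * t ^ 4)
        - k * (l0 + l1 * t) * ((1 + S * u + N * u ^ 2) * (1 + T * t + M * t ^ 2)) = 0"
      unfolding nd n2 by (simp add: n_def)
    moreover have "poly p0 t + u * poly p1 t + u ^ 2 * poly p2 t =
      k ^ (\<delta> + 2) + t * k ^ 2 * (1 + S * u + N * u ^ 2) + u * k ^ \<delta> * (1 + T ^ 2 * t ^ 2 + M ^ 2 * t ^ 4)
        - k * (l0 + l1 * t) * ((1 + S * u + N * u ^ 2) * (1 + T * t + M * t ^ 2))"
      by (simp add: p0_def p1_def p2_def b0_def b1_def b2_def b3_def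
          power2_eq_square power4_eq_xxxx algebra_simps)
    ultimately show ?thesis by (simp add: u_def)
  qed
  have "b3 = 0 \<and> b2 = 0 \<and> k ^ (\<delta> + 2) = b0"
    using \<epsilon>_cases
  proof (elim disjE conjE)
    assume "\<epsilon> \<ge> 4"
    then have d: "\<delta> \<ge> 8" "2 * \<delta> + 3 < q"
    proof -
      show "\<delta> \<ge> 8" using \<open>\<epsilon> \<ge> 4\<close> \<delta>_\<epsilon>(1) by simp
      have "4 * \<delta> \<le> q" using \<open>\<epsilon> \<ge> 4\<close> \<delta>_\<epsilon>(2) by (metis mult_le_mono1)
      then show "2 * \<delta> + 3 < q" using \<open>\<delta> \<ge> 8\<close> by simp
    qed
    define p where "p = p0 + monom 1 \<delta> * p1 + monom 1 (2 * \<delta>) * p2"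
    have deg: "degree p0 \<le> 3" "degree p1 \<le> 4" "degree p2 \<le> 3"
      by (simp_all add: p0_def p1_def p2_def degree_pCons_eq_if)
    have "degree p \<le> 2 * \<delta> + 3"
      unfolding p_def using d deg
      by (intro degree_add_le order.trans[OF degree_mult_le]) (auto simp: degree_monom_eq)
    then have "degree p < card F" using card_F d by simp
    moreover have "poly p t = 0" if "t \<in> F" for t
    proof -
      have "t ^ (2 * \<delta>) = (t ^ \<delta>) ^ 2" by (simp add: mult.commute flip: power_mult)
      then show ?thesis using zero[of t] that by (simp add: p_def poly_monom)
    qed
    ultimately have "p = 0" using card_roots_le by blast
    then have c: "coeff p i = 0" for i by simp
    have coeff_p: "coeff p i = coeff p0 i + (if \<delta> \<le> i then coeff p1 (i - \<delta>) else 0)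
        + (if 2 * \<delta> \<le> i then coeff p2 (i - 2 * \<delta>) else 0)" for i
      by (simp add: p_def coeff_monom_mult)
    have "coeff p0 (\<delta> + 3) = 0" using d deg by (intro coeff_eq_0) simp
    then have "coeff p (\<delta> + 3) = coeff p1 3" using d by (simp add: coeff_p)
    also have "\<dots> = - S * b3" by (simp add: p1_def eval_nat_numeral)
    finally have "coeff p (\<delta> + 3) = - S * b3" .
    moreover have "coeff p 2 = coeff p0 2" "coeff p 0 = coeff p0 0" using d by (simp_all add: coeff_p)
    then have "coeff p 2 = - b2" "coeff p 0 = k ^ (\<delta> + 2) - b0"
      by (simp_all add: p0_def eval_nat_numeral)
    ultimately show ?thesis using c S by simp
  next
    assume q: "q = 8" and d: "\<delta> = 4"
    define p where "p = [: k ^ 6 - b0, k ^ 2 - b1 + k ^ 4 * M ^ 2 - N * b0, - b2 + N * (k ^ 2 - b1),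
      - b3 - N * b2, k ^ 4 - S * b0 - N * b3, S * (k ^ 2 - b1), k ^ 4 * T ^ 2 - S * b2, - S * b3 :]"
    have "poly p t = 0" if "t \<in> F" for t
    proof -
      have "cj t = t" using that by simp
      moreover have "cj t = t ^ q" by (rule cj_def)
      ultimately have t8: "t ^ 8 = t" by (simp only: q)
      have "poly p0 t + t ^ 4 * poly p1 t + t ^ 8 * poly p2 t = 0"
        using zero[of t] that by (simp add: d flip: power_mult)
      then have "poly p0 t + t ^ 4 * poly p1 t + t * poly p2 t = 0" by (simp only: t8)
      moreover have "poly p t = poly p0 t + t ^ 4 * poly p1 t + t * poly p2 t - (k ^ 4 * M ^ 2) * (t ^ 8 - t)"
        by (simp add: p_def p0_def p1_def p2_def d eval_nat_numeral algebra_simps)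
      ultimately show ?thesis by (simp add: t8)
    qed
    moreover have "degree p \<le> 7" by (simp add: p_def degree_pCons_eq_if)
    moreover have "card F = 8" using card_F q by (rule trans)
    ultimately have "p = 0" using card_roots_le[of F p] by simp
    then have "coeff p 3 = 0" and "b3 = 0" "k ^ 6 = b0" using S by (simp, simp_all add: p_def)
    moreover have "coeff p 3 = - b3 - N * b2" by (simp add: p_def eval_nat_numeral)
    ultimately show ?thesis using N by (simp add: d)
  qed
  then have "l1 = 0" "l0 = 0" "k ^ (\<delta> + 2) = k * l0"
    using k M by (auto simp: b0_def b2_def b3_def)
  then show False using k by simp
qed

text \<open>
  With slope \<open>c = cj \<beta>\<close> the admissible \<open>cj (e c / z)\<close> are the points of a circle through \<open>0\<close> which is
  tangent to \<open>F \<beta>\<close> there. The line of slope \<open>t\<close> through \<open>0\<close> meets it again in \<open>r (1 + t \<beta>)\<close> with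
  \<open>r\<close> a constant divided by \<open>nm (1 + t \<beta>)\<close>. On the circle \<open>tits\<close> has to agree with a linear function,
  and in terms of \<open>t\<close> this is the polynomial identity excluded above.
\<close>

lemma not_elation_property_BT_set:
  "\<not> elation_property (q + 3) (points - BT_set q \<delta> \<beta>) (adj (BT_set q \<delta> \<beta>))"
proof
  assume el: "elation_property (q + 3) (points - BT_set q \<delta> \<beta>) (adj (BT_set q \<delta> \<beta>))"
  define \<kappa> where "\<kappa> = \<beta> - cj \<beta>"
  have \<kappa>: "\<kappa> \<noteq> 0" "cj \<kappa> = - \<kappa>" using \<beta> by (auto simp: \<kappa>_def)
  have \<beta>0: "\<beta> \<noteq> 0" using \<beta> by auto
  then have c0: "cj \<beta> \<noteq> 0" by simp
  obtain e x' where e: "e \<noteq> 0" "cj e = e"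
    and eqn: "\<And>z. z - cj z = tits_form \<beta> + (cj \<beta> * x' - \<beta> * cj x') \<Longrightarrow>
       z \<noteq> 0 \<and> - (x' * (e * cj \<beta> / z)) + cj (x' * (e * cj \<beta> / z)) = tits_form (cj (e * cj \<beta> / z))"
    using elation_property_affine_curve[where \<Phi> = tits_form and \<Psi> = "\<lambda>n. tits_form (cj n)" and c = "cj \<beta>",
        OF cj_tits_form cj_tits_form tits_form_eq_0_iff _ tangent_tits_iff el[unfolded BT_set_eq] c0]
      tits_form_eq_0_iff
    by (simp del: cj_mult cj_divide) (auto simp del: cj_divide)
  define \<psi> where "\<psi> = tits_form \<beta> + (cj \<beta> * x' - \<beta> * cj x')"
  have c\<psi>: "cj \<psi> = - \<psi>" by (simp add: \<psi>_def cj_tits_form)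
  have \<psi>0: "\<psi> \<noteq> 0" using eqn[of 0] by (auto simp: \<psi>_def)
  define k where "k = - e * \<kappa> / \<psi>"
  have k: "k \<noteq> 0" "cj k = k" using e \<kappa> \<psi>0 by (simp_all add: k_def c\<psi>)
  define l0 where "l0 = (cj x' - x') / \<kappa>"
  define l1 where "l1 = (cj x' * \<beta> - x' * cj \<beta>) / \<kappa>"
  define T where "T = \<beta> + cj \<beta>"
  define M where "M = nm \<beta>"
  have "T \<noteq> 0" using \<beta> minus_eq by (metis T_def add_eq_0_iff2)
  moreover have "M \<noteq> 0" using \<beta>0 by (simp add: M_def nm_def)
  moreover have "k ^ (\<delta> + 2) + t * k ^ 2 * (1 + T * t + M * t ^ 2) ^ \<delta> + t ^ \<delta> * k ^ \<delta> * (1 + T * t + M * t ^ 2) ^ 2 =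
      k * (l0 + l1 * t) * (1 + T * t + M * t ^ 2) ^ (\<delta> + 1)" if t: "cj t = t" for t
  proof -
    define n where "n = 1 + T * t + M * t ^ 2"
    have n: "n = nm (1 + t * \<beta>)"
      by (simp add: n_def nm_def T_def M_def t power2_eq_square algebra_simps)
    have "1 + t * \<beta> \<noteq> 0"
    proof
      assume "1 + t * \<beta> = 0"
      then have "cj (1 + t * \<beta>) = 1 + t * \<beta>" by simp
      then have "t = 0" using \<beta> by (simp add: t)
      then show False using \<open>1 + t * \<beta> = 0\<close> by simp
    qed
    then have n0: "n \<noteq> 0" unfolding n by (simp only: nm_eq_0_iff not_False_eq_True)
    have cn: "cj n = n" by (simp add: n nm_def mult.commute)
    define r where "r = k / n"
    have r: "r \<noteq> 0" "cj r = r" using k n0 by (simp_all add: r_def cn)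
    define x where "x = r * (1 + t * \<beta>)"
    have x0: "x \<noteq> 0" using r \<open>1 + t * \<beta> \<noteq> 0\<close> by (simp add: x_def)
    define z where "z = e * cj \<beta> / cj x"
    have z_tr: "z - cj z = \<psi>"
    proof -
      have "cj \<beta> * x - \<beta> * cj x = - \<kappa> * r" by (simp add: x_def r t \<kappa>_def algebra_simps)
      moreover have "nm x = r * k"
      proof -
        have "nm x = r * cj r * nm (1 + t * \<beta>)" by (simp add: x_def nm_def)
        then show ?thesis using n0 unfolding n[symmetric] r(2) by (simp add: r_def)
      qed
      moreover have "z - cj z = e * (cj \<beta> * x - \<beta> * cj x) / nm x"
        using x0 by (simp add: z_def nm_def e field_simps)
      ultimately have "z - cj z = - e * \<kappa> / k" using r by simp
      then show ?thesis using e \<kappa> \<psi>0 by (simp add: k_def)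
    qed
    have "e * cj \<beta> / z = cj x" using e \<beta>0 by (simp add: z_def)
    then have "- (x' * cj x) + cj x' * x = tits_form x"
      using eqn[of z] z_tr by (simp add: \<psi>_def)
    moreover have "- (x' * cj x) + cj x' * x = \<kappa> * (r * (l0 + l1 * t))"
      using \<kappa> by (simp add: l0_def l1_def x_def r t field_simps)
    moreover have "tits_form x = \<kappa> * tits r (r * t)"
    proof -
      have "x = r + r * t * \<beta>" by (simp add: x_def algebra_simps)
      moreover have "cj (r * t) = r * t" by (simp add: r t)
      ultimately show ?thesis using r by (simp add: tits_form_def co_unique \<kappa>_def)
    qed
    ultimately have "tits r (r * t) = r * (l0 + l1 * t)" using \<kappa> by simp
    then have scaled: "n ^ (\<delta> + 2) * (r ^ (\<delta> + 2) + r ^ 2 * t + r ^ \<delta> * t ^ \<delta>) = n ^ (\<delta> + 2) * (r * (l0 + l1 * t))"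
      by (simp add: tits_def power_mult_distrib power2_eq_square mult.assoc)
    have lhs: "n ^ (\<delta> + 2) * (r ^ (\<delta> + 2) + r ^ 2 * t + r ^ \<delta> * t ^ \<delta>) =
        (n * r) ^ (\<delta> + 2) + t * (n * r) ^ 2 * n ^ \<delta> + t ^ \<delta> * (n * r) ^ \<delta> * n ^ 2"
      by (simp add: power_add power_mult_distrib power2_eq_square algebra_simps)
    have rhs: "n ^ (\<delta> + 2) * (r * (l0 + l1 * t)) = (n * r) * (l0 + l1 * t) * n ^ (\<delta> + 1)"
      by (simp add: power_add power2_eq_square algebra_simps)
    have "n * r = k" using n0 by (simp add: r_def)
    then show ?thesis using scaled unfolding lhs rhs by (simp only: n_def)
  qed
  ultimately show False using tits_polynomial_identity[OF k(1)] by blast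
qed

end

section \<open>Non-isomorphism\<close>

theorem theorem3p6:
  fixes q :: nat and U H :: "('k::{field,finite} ^ 3) set set"
  assumes "primepow q" and "q > 2" and "CARD('k) = q ^ 2"
    and "Buekenhout_unital q U" and "\<not> hermitian_curve q U"
    and "hermitian_curve q H"
  shows "\<not> digraph_iso (with_proj (tangent_graph U)) (with_proj (tangent_graph H))"
proof
  assume iso: "digraph_iso (with_proj (tangent_graph U)) (with_proj (tangent_graph H))"
  interpret quadratic_field q "TYPE('k)"
    by unfold_locales (use assms in auto)
  have "elation_property (q + 3) (points - H) (adj H)"
    using assms(6) by (rule hermitian_curve_elation_property)
  then have el: "elation_property (q + 3) (points - U) (adj U)"
    by (rule elation_property_digraph_iso[OF iso])
  from assms(4) show False
    unfolding Buekenhout_unital_def orthogonal_Buekenhout_Metz_unital_def Buekenhout_Tits_unital_def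
  proof (elim disjE exE conjE)
    fix \<alpha> \<beta> :: 'k
    assume params: "BM_params q \<alpha> \<beta>" and eq: "proj_equiv (BM_set q \<alpha> \<beta>) U"
    have "\<alpha> \<noteq> 0"
      using params eq assms(5) hermitian_curve_BM_set hermitian_curve_proj_equiv by blast
    moreover have "elation_property (q + 3) (points - BM_set q \<alpha> \<beta>) (adj (BM_set q \<alpha> \<beta>))"
      using elation_property_proj_equiv[OF eq el] by (simp add: BM_set_eq affine_curve_subset_points)
    ultimately show False using not_elation_property_BM_set[OF params] by blast
  next
    fix m :: nat and \<beta> :: 'k
    assume m: "q = 2 ^ m" "m > 1" "odd m" and \<beta>: "\<beta> \<notin> GFq q"
      and eq: "proj_equiv (BT_set q (2 ^ ((m + 1) div 2)) \<beta>) U"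
    have "cj \<beta> \<noteq> \<beta>" using \<beta> unfolding GFq_def cj_def by blast
    then interpret t: tits_field q "TYPE('k)" m \<beta>
      by unfold_locales (use m in auto)
    have "proj_equiv (BT_set q t.\<delta> \<beta>) U" using eq by (simp add: t.\<delta>_def)
    then have "elation_property (q + 3) (points - BT_set q t.\<delta> \<beta>) (adj (BT_set q t.\<delta> \<beta>))"
      using elation_property_proj_equiv[OF _ el] by (simp add: t.BT_set_eq affine_curve_subset_points)
    then show False using t.not_elation_property_BT_set by blast
  qed
qed

end
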